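(* Let $K$ be an irreducible Markov kernel on $\mathcal{X}=\{1,\dots,n\}$ with stationary distribution $\pi$, Dirichlet form $\mathcal{E}$ and log-Sobolev constant $\alpha$. Let $\epsilon\in(0,1)$ and let $P\in\mathbb{R}[x_1,\dots,x_n]$ be a polynomial such that $\mathrm{Ent}_\pi[x^2]\le P(x)\le(1+\epsilon)\mathrm{Ent}_\pi[x^2]$ for all $x\in S^\pi$. For $d\ge\frac12\deg P$ let $\gamma_d^*=\inf\{\gamma\in\mathbb{R}:\gamma\,\mathcal{E}(x,x)-P(x)\in\mathsf{SOS}_d(S^\pi)\}$ (with $\gamma_d^*=+\infty$ if the set is empty) and $\alpha_d^P=1/\gamma_d^*$ (with $1/(+\infty)=0$). Then $\alpha_d^P\le\alpha$ for all such $d$, and there exists $d_0\in\mathbb{N}$ such that $\alpha_d^P\ge(1-\epsilon)\alpha$ for every $d\ge d_0$.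
   Context: A Markov kernel $K$ on $\mathcal{X}$ is a matrix with $K_{ij}\ge0$, $\sum_j K_{ij}=1$; irreducibility gives a unique stationary distribution $\pi$ with all $\pi_i>0$. Dirichlet form: $\mathcal{E}(x,x)=\frac12\sum_{i,j}\pi_iK_{ij}(x_i-x_j)^2$. Write $\|x\|_\pi^2=\sum_i\pi_ix_i^2$ and $\mathrm{Ent}_\pi[x^2]=\sum_i\pi_ix_i^2\log(x_i^2/\|x\|_\pi^2)$. The log-Sobolev constant $\alpha$ is the largest constant with $\mathcal{E}(x,x)\ge\alpha\,\mathrm{Ent}_\pi[x^2]$ for all $x\in\mathbb{R}^n$. $S^\pi=\{x\in\mathbb{R}^n_{\ge0}:\|x\|_\pi^2=1\}$. $\Sigma[x]_{2k}$ denotes sums of squares of polynomials of degree $\le k$. Define $\mathsf{SOS}_d(S^\pi)=\{f\in\mathbb{R}[x]_{2d}: f=\sigma_0+\sum_{i=1}^n x_i\sigma_i+\phi\,(\|x\|_\pi^2-1),\ \sigma_0\in\Sigma[x]_{2d},\ \sigma_i\in\Sigma[x]_{2d-2},\ \phi\in\mathbb{R}[x]_{2d-2}\}$. *)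

theory Defs
  imports Complex_Main
begin

text \<open>State space X = {0..<n} (the paper's {1..n}, shifted). Vectors x in R^n are
  functions nat => real, only the coordinates x i with i < n matter.
  Polynomials in n variables over R are represented by the polynomial functions they
  induce on R^n (faithful since R is infinite).\<close>

definition monomials_le :: "nat \<Rightarrow> nat \<Rightarrow> (nat \<Rightarrow> nat) set" where
  "monomials_le n k = {a. (\<forall>i. n \<le> i \<longrightarrow> a i = 0) \<and> (\<Sum>i<n. a i) \<le> k}"

definition monom_eval :: "nat \<Rightarrow> (nat \<Rightarrow> nat) \<Rightarrow> (nat \<Rightarrow> real) \<Rightarrow> real" where
  "monom_eval n a x = (\<Prod>i<n. x i ^ a i)"

definition poly_deg_le :: "nat \<Rightarrow> nat \<Rightarrow> ((nat \<Rightarrow> real) \<Rightarrow> real) \<Rightarrow> bool" where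
  "poly_deg_le n k f \<longleftrightarrow>
     (\<exists>c. f = (\<lambda>x. \<Sum>a\<in>monomials_le n k. c a * monom_eval n a x))"

definition is_poly :: "nat \<Rightarrow> ((nat \<Rightarrow> real) \<Rightarrow> real) \<Rightarrow> bool" where
  "is_poly n f \<longleftrightarrow> (\<exists>k. poly_deg_le n k f)"

definition poly_degree :: "nat \<Rightarrow> ((nat \<Rightarrow> real) \<Rightarrow> real) \<Rightarrow> nat" where
  "poly_degree n f = (LEAST k. poly_deg_le n k f)"

definition sos :: "nat \<Rightarrow> nat \<Rightarrow> ((nat \<Rightarrow> real) \<Rightarrow> real) \<Rightarrow> bool" where
  "sos n k f \<longleftrightarrow>
     (\<exists>gs. (\<forall>g\<in>set gs. poly_deg_le n k g) \<and> f = (\<lambda>x. \<Sum>g\<leftarrow>gs. (g x)\<^sup>2))"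

definition norm_pi_sq :: "nat \<Rightarrow> (nat \<Rightarrow> real) \<Rightarrow> (nat \<Rightarrow> real) \<Rightarrow> real" where
  "norm_pi_sq n \<pi> x = (\<Sum>i<n. \<pi> i * (x i)\<^sup>2)"

text \<open>SOS_d(S^pi). For d = 0 the multipliers sigma_i in Sigma[x]_{-2} and phi in R[x]_{-2}
  are necessarily zero.\<close>
definition SOS_S :: "nat \<Rightarrow> (nat \<Rightarrow> real) \<Rightarrow> nat \<Rightarrow> ((nat \<Rightarrow> real) \<Rightarrow> real) set" where
  "SOS_S n \<pi> d = {f. poly_deg_le n (2*d) f \<and>
     (\<exists>\<sigma>0 \<sigma> \<phi>. sos n d \<sigma>0 \<and>
        (\<forall>i<n. sos n (d - 1) (\<sigma> i)) \<and> poly_deg_le n (2*d - 2) \<phi> \<and>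
        (d = 0 \<longrightarrow> (\<forall>i<n. \<sigma> i = (\<lambda>x. 0)) \<and> \<phi> = (\<lambda>x. 0)) \<and>
        f = (\<lambda>x. \<sigma>0 x + (\<Sum>i<n. x i * \<sigma> i x) + \<phi> x * (norm_pi_sq n \<pi> x - 1)))}"

definition S_pi :: "nat \<Rightarrow> (nat \<Rightarrow> real) \<Rightarrow> (nat \<Rightarrow> real) set" where
  "S_pi n \<pi> = {x. (\<forall>i<n. 0 \<le> x i) \<and> norm_pi_sq n \<pi> x = 1}"

definition markov_kernel :: "nat \<Rightarrow> (nat \<Rightarrow> nat \<Rightarrow> real) \<Rightarrow> bool" where
  "markov_kernel n K \<longleftrightarrow> (\<forall>i<n. (\<forall>j<n. 0 \<le> K i j) \<and> (\<Sum>j<n. K i j) = 1)"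

fun kpow :: "nat \<Rightarrow> (nat \<Rightarrow> nat \<Rightarrow> real) \<Rightarrow> nat \<Rightarrow> nat \<Rightarrow> nat \<Rightarrow> real" where
  "kpow n K 0 i j = (if i = j then 1 else 0)"
| "kpow n K (Suc m) i j = (\<Sum>l<n. kpow n K m i l * K l j)"

definition irreducible_kernel :: "nat \<Rightarrow> (nat \<Rightarrow> nat \<Rightarrow> real) \<Rightarrow> bool" where
  "irreducible_kernel n K \<longleftrightarrow> (\<forall>i<n. \<forall>j<n. \<exists>m. 0 < kpow n K m i j)"

definition stationary :: "nat \<Rightarrow> (nat \<Rightarrow> nat \<Rightarrow> real) \<Rightarrow> (nat \<Rightarrow> real) \<Rightarrow> bool" where
  "stationary n K \<pi> \<longleftrightarrow> (\<forall>i<n. 0 \<le> \<pi> i) \<and> (\<Sum>i<n. \<pi> i) = 1 \<and>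
     (\<forall>j<n. (\<Sum>i<n. \<pi> i * K i j) = \<pi> j)"

definition dirichlet :: "nat \<Rightarrow> (nat \<Rightarrow> nat \<Rightarrow> real) \<Rightarrow> (nat \<Rightarrow> real) \<Rightarrow> (nat \<Rightarrow> real) \<Rightarrow> real" where
  "dirichlet n K \<pi> x = (1/2) * (\<Sum>i<n. \<Sum>j<n. \<pi> i * K i j * (x i - x j)\<^sup>2)"

definition ent :: "nat \<Rightarrow> (nat \<Rightarrow> real) \<Rightarrow> (nat \<Rightarrow> real) \<Rightarrow> real" where
  "ent n \<pi> x = (\<Sum>i<n. if x i = 0 then 0
       else \<pi> i * (x i)\<^sup>2 * ln ((x i)\<^sup>2 / norm_pi_sq n \<pi> x))"

definition log_sobolev :: "nat \<Rightarrow> (nat \<Rightarrow> nat \<Rightarrow> real) \<Rightarrow> (nat \<Rightarrow> real) \<Rightarrow> real" where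
  "log_sobolev n K \<pi> = Sup {a. \<forall>x. a * ent n \<pi> x \<le> dirichlet n K \<pi> x}"

definition gamma_set :: "nat \<Rightarrow> (nat \<Rightarrow> nat \<Rightarrow> real) \<Rightarrow> (nat \<Rightarrow> real) \<Rightarrow>
    ((nat \<Rightarrow> real) \<Rightarrow> real) \<Rightarrow> nat \<Rightarrow> real set" where
  "gamma_set n K \<pi> P d = {\<gamma>. (\<lambda>x. \<gamma> * dirichlet n K \<pi> x - P x) \<in> SOS_S n \<pi> d}"

text \<open>alpha_d^P = 1 / gamma_d^*, with gamma_d^* = +infinity (so alpha_d^P = 0) if the set is empty\<close>
definition alpha_P :: "nat \<Rightarrow> (nat \<Rightarrow> nat \<Rightarrow> real) \<Rightarrow> (nat \<Rightarrow> real) \<Rightarrow>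
    ((nat \<Rightarrow> real) \<Rightarrow> real) \<Rightarrow> nat \<Rightarrow> real" where
  "alpha_P n K \<pi> P d =
     (if gamma_set n K \<pi> P d = {} then 0 else 1 / Inf (gamma_set n K \<pi> P d))"

end

theory Submission
  imports Defs "HOL-Analysis.Analysis"
begin

text \<open>
  Every \<open>\<gamma>\<close> admitted at some level satisfies \<open>\<gamma> \<E> \<ge> P \<ge> Ent\<close> on \<open>S\<^sup>\<pi>\<close>, hence everywhere by
  homogeneity and \<open>\<E>(|x|) \<le> \<E>(x)\<close>; this gives the upper bound. For the lower bound take
  \<open>\<gamma> = 1 / ((1 - \<epsilon>) \<alpha>)\<close>. Since \<open>1 / (1 - \<epsilon>) > 1 + \<epsilon>\<close>, the polynomial \<open>f = \<gamma> \<E> - P\<close> dominates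
  \<open>c \<E>\<close> on \<open>S\<^sup>\<pi>\<close> for some \<open>c > 0\<close>, so its only zero there is the interior point \<open>e = (1, \<dots>, 1)\<close>,
  where the tangential Hessian is positive definite. Such an \<open>f\<close> has a certificate: with
  \<open>y = x - e\<close>, Taylor expansion gives \<open>f \<equiv> y\<^sup>T A(x) y\<close> modulo \<open>s = \<parallel>x\<parallel>\<^sup>2 - 1\<close>, and adding to \<open>A\<close> multiples
  of \<open>\<parallel>y\<parallel>\<^sup>2 I - y y\<^sup>T\<close> (which annihilates \<open>y\<close>), of \<open>s\<^sup>2 I\<close>, and of \<open>- x\<^sub>i h(x\<^sub>i)\<^sup>2 I\<close> makes it
  positive definite on a whole cube \<open>[-N, N]\<^sup>n\<close>. For a large degree its Bernstein coefficients on the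
  cube are then positive definite matrices, while \<open>N \<plusminus> x\<^sub>i\<close>, and so each Bernstein basis polynomial,
  is a sum of squares modulo \<open>s\<close>.
\<close>

section \<open>Polynomial functions\<close>

text \<open>Exponent vectors are functions on all of \<open>nat\<close>, so finiteness needs an
  argument; over an infinite set the sum in \<open>poly_deg_le\<close> would default to 0.\<close>

lemma finite_monomials_le: "finite (monomials_le n k)"
proof -
  have "monomials_le n k \<subseteq> {a. \<forall>i. (i \<in> {..<n} \<longrightarrow> a i \<in> {..k}) \<and> (i \<notin> {..<n} \<longrightarrow> a i = 0)}"
  proof
    fix a assume a: "a \<in> monomials_le n k"
    have "a i \<le> k" if "i < n" for i
    proof -
      have "a i \<le> (\<Sum>i<n. a i)" using that by (intro member_le_sum) auto
      then show ?thesis using a by (simp add: monomials_le_def)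
    qed
    then show "a \<in> {a. \<forall>i. (i \<in> {..<n} \<longrightarrow> a i \<in> {..k}) \<and> (i \<notin> {..<n} \<longrightarrow> a i = 0)}"
      using a by (auto simp: monomials_le_def)
  qed
  moreover have "finite {a. \<forall>i. (i \<in> {..<n} \<longrightarrow> a i \<in> {..k}) \<and> (i \<notin> {..<n} \<longrightarrow> a i = (0::nat))}"
    by (rule finite_set_of_finite_funs) auto
  ultimately show ?thesis by (rule finite_subset)
qed

lemma poly_deg_le_monom:
  assumes "a \<in> monomials_le n k"
  shows "poly_deg_le n k (\<lambda>x. c * monom_eval n a x)"
  unfolding poly_deg_le_def
proof (intro exI[of _ "\<lambda>b. if b = a then c else 0"] ext)
  fix x
  have "(\<Sum>b\<in>monomials_le n k. (if b = a then c else 0) * monom_eval n b x)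
      = (\<Sum>b\<in>monomials_le n k. if b = a then c * monom_eval n a x else 0)"
    by (intro sum.cong) auto
  then show "c * monom_eval n a x
      = (\<Sum>b\<in>monomials_le n k. (if b = a then c else 0) * monom_eval n b x)"
    using assms finite_monomials_le by simp
qed

lemma poly_deg_le_zero: "poly_deg_le n k (\<lambda>x. 0)"
  unfolding poly_deg_le_def by (intro exI[of _ "\<lambda>a. 0"]) auto

lemma poly_deg_le_add:
  assumes "poly_deg_le n k f" "poly_deg_le n k g"
  shows "poly_deg_le n k (\<lambda>x. f x + g x)"
proof -
  from assms obtain c d where "f = (\<lambda>x. \<Sum>a\<in>monomials_le n k. c a * monom_eval n a x)"
    "g = (\<lambda>x. \<Sum>a\<in>monomials_le n k. d a * monom_eval n a x)"
    by (auto simp: poly_deg_le_def)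
  then show ?thesis unfolding poly_deg_le_def
    by (intro exI[of _ "\<lambda>a. c a + d a"]) (auto simp: sum.distrib algebra_simps)
qed

lemma poly_deg_le_cmult:
  assumes "poly_deg_le n k f"
  shows "poly_deg_le n k (\<lambda>x. c * f x)"
proof -
  from assms obtain d where "f = (\<lambda>x. \<Sum>a\<in>monomials_le n k. d a * monom_eval n a x)"
    by (auto simp: poly_deg_le_def)
  then show ?thesis unfolding poly_deg_le_def
    by (intro exI[of _ "\<lambda>a. c * d a"]) (auto simp: sum_distrib_left algebra_simps)
qed

lemma poly_deg_le_sum:
  "(\<And>i. i \<in> I \<Longrightarrow> poly_deg_le n k (f i)) \<Longrightarrow> poly_deg_le n k (\<lambda>x. \<Sum>i\<in>I. f i x)"
  by (induction I rule: infinite_finite_induct) (auto intro: poly_deg_le_zero poly_deg_le_add)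

lemma poly_deg_le_mono:
  assumes "poly_deg_le n k f" "k \<le> l"
  shows "poly_deg_le n l f"
proof -
  from assms obtain d where f: "f = (\<lambda>x. \<Sum>a\<in>monomials_le n k. d a * monom_eval n a x)"
    by (auto simp: poly_deg_le_def)
  have "monomials_le n k \<subseteq> monomials_le n l" using assms(2) by (auto simp: monomials_le_def)
  then show ?thesis unfolding f by (intro poly_deg_le_sum poly_deg_le_monom) auto
qed

lemma monom_eval_add: "monom_eval n (\<lambda>i. a i + b i) x = monom_eval n a x * monom_eval n b x"
  by (simp add: monom_eval_def power_add prod.distrib)

lemma poly_deg_le_mult:
  assumes "poly_deg_le n k f" "poly_deg_le n l g"
  shows "poly_deg_le n (k + l) (\<lambda>x. f x * g x)"
proof -
  from assms obtain c d where f: "f = (\<lambda>x. \<Sum>a\<in>monomials_le n k. c a * monom_eval n a x)"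
    and g: "g = (\<lambda>x. \<Sum>a\<in>monomials_le n l. d a * monom_eval n a x)"
    by (auto simp: poly_deg_le_def)
  have eq: "(\<lambda>x. f x * g x) = (\<lambda>x. \<Sum>a\<in>monomials_le n k. \<Sum>b\<in>monomials_le n l.
      (c a * d b) * monom_eval n (\<lambda>i. a i + b i) x)"
    unfolding f g by (auto simp: sum_product monom_eval_add algebra_simps)
  have "(\<lambda>i. a i + b i) \<in> monomials_le n (k + l)"
    if "a \<in> monomials_le n k" "b \<in> monomials_le n l" for a b
    using that by (auto simp: monomials_le_def sum.distrib)
  then show ?thesis unfolding eq by (intro poly_deg_le_sum poly_deg_le_monom) auto
qed

lemma poly_deg_le_const: "poly_deg_le n k (\<lambda>x. c)"
proof -
  have "(\<lambda>i. 0) \<in> monomials_le n k" by (simp add: monomials_le_def)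
  from poly_deg_le_monom[OF this, of c] show ?thesis by (simp add: monom_eval_def)
qed

lemma poly_deg_le_coord:
  assumes "i < n" shows "poly_deg_le n 1 (\<lambda>x. x i)"
proof -
  have "(\<lambda>j. if j = i then 1 else 0) \<in> monomials_le n 1"
    using assms by (auto simp: monomials_le_def)
  from poly_deg_le_monom[OF this, of 1]
  have "poly_deg_le n 1 (\<lambda>x. monom_eval n (\<lambda>j. if j = i then 1 else 0) x)" by simp
  moreover have "monom_eval n (\<lambda>j. if j = i then 1 else 0) x = x i" for x
  proof -
    have "monom_eval n (\<lambda>j. if j = i then 1 else 0) x = (\<Prod>j<n. if j = i then x j else 1)"
      unfolding monom_eval_def by (intro prod.cong) auto
    then show ?thesis using assms by simp
  qed
  ultimately show ?thesis by simp
qed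

section \<open>Polynomials of unspecified degree: closure, induction, Taylor expansion\<close>

lemma is_poly_const [intro!]: "is_poly n (\<lambda>x. c)"
  unfolding is_poly_def using poly_deg_le_const by blast

lemma is_poly_coord [intro]: "i < n \<Longrightarrow> is_poly n (\<lambda>x. x i)"
  unfolding is_poly_def using poly_deg_le_coord by blast

lemma is_poly_add [intro!]:
  assumes "is_poly n f" "is_poly n g" shows "is_poly n (\<lambda>x. f x + g x)"
proof -
  from assms obtain k l where "poly_deg_le n k f" "poly_deg_le n l g" by (auto simp: is_poly_def)
  then have "poly_deg_le n (max k l) f" "poly_deg_le n (max k l) g"
    by (auto elim: poly_deg_le_mono)
  then show ?thesis unfolding is_poly_def by (blast intro: poly_deg_le_add)
qed

lemma is_poly_mult [intro!]:
  assumes "is_poly n f" "is_poly n g" shows "is_poly n (\<lambda>x. f x * g x)"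
  using assms unfolding is_poly_def by (blast intro: poly_deg_le_mult)

lemma is_poly_uminus [intro!]: "is_poly n f \<Longrightarrow> is_poly n (\<lambda>x. - f x)"
  using is_poly_mult[of n "\<lambda>x. -1" f] by auto

lemma is_poly_diff [intro!]: "is_poly n f \<Longrightarrow> is_poly n g \<Longrightarrow> is_poly n (\<lambda>x. f x - g x)"
  using is_poly_add[of n f "\<lambda>x. - g x"] by auto

lemma is_poly_divide [intro!]: "is_poly n f \<Longrightarrow> is_poly n (\<lambda>x. f x / c)"
  using is_poly_mult[of n f "\<lambda>x. inverse c"] by (auto simp: divide_inverse)

lemma is_poly_power [intro!]: "is_poly n f \<Longrightarrow> is_poly n (\<lambda>x. f x ^ k)"
  by (induction k) auto

lemma is_poly_sum [intro!]:
  "(\<And>i. i \<in> I \<Longrightarrow> is_poly n (f i)) \<Longrightarrow> is_poly n (\<lambda>x. \<Sum>i\<in>I. f i x)"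
  by (induction I rule: infinite_finite_induct) auto

text \<open>Reduces claims about polynomials to the ring operations, so that composition, continuity
  and Taylor expansion need no coefficient bookkeeping.\<close>

lemma is_poly_induct [consumes 1, case_names const coord add mult]:
  assumes "is_poly n f"
    and const: "\<And>c. Q (\<lambda>x. c)"
    and coord: "\<And>i. i < n \<Longrightarrow> Q (\<lambda>x. x i)"
    and add: "\<And>f g. is_poly n f \<Longrightarrow> is_poly n g \<Longrightarrow> Q f \<Longrightarrow> Q g \<Longrightarrow> Q (\<lambda>x. f x + g x)"
    and mult: "\<And>f g. is_poly n f \<Longrightarrow> is_poly n g \<Longrightarrow> Q f \<Longrightarrow> Q g \<Longrightarrow> Q (\<lambda>x. f x * g x)"
  shows "Q f"
proof -
  let ?R = "\<lambda>f. is_poly n f \<and> Q f"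
  have Rs: "?R (\<lambda>x. \<Sum>i\<in>I. h i x)" if "\<And>i. i \<in> I \<Longrightarrow> ?R (h i)" for I :: "(nat \<Rightarrow> nat) set" and h
    using that by (induction I rule: infinite_finite_induct) (auto intro!: const add)
  have Rp: "?R (\<lambda>x. \<Prod>i\<in>I. h i x)" if "\<And>i. i \<in> I \<Longrightarrow> ?R (h i)" for I :: "nat set" and h
    using that by (induction I rule: infinite_finite_induct) (auto intro!: const mult)
  have Rpow: "?R (\<lambda>x. h x ^ k)" if "?R h" for h k
    using that by (induction k) (auto intro!: const mult)
  from assms(1) obtain k c where "f = (\<lambda>x. \<Sum>a\<in>monomials_le n k. c a * monom_eval n a x)"
    by (auto simp: is_poly_def poly_deg_le_def)
  moreover have "?R (\<lambda>x. \<Sum>a\<in>monomials_le n k. c a * monom_eval n a x)"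
  proof (rule Rs)
    fix a
    have "?R (monom_eval n a)" unfolding monom_eval_def
      by (intro Rp Rpow) (auto intro: coord)
    then show "?R (\<lambda>x. c a * monom_eval n a x)" using const mult[OF is_poly_const] by auto
  qed
  ultimately show ?thesis by simp
qed

lemma is_poly_compose:
  assumes "is_poly n f" "\<And>i. i < n \<Longrightarrow> is_poly n (g i)"
  shows "is_poly n (\<lambda>x. f (\<lambda>i. g i x))"
  using assms(1) by (induction rule: is_poly_induct) (auto intro: assms(2))

text \<open>Allows points to be truncated to zero from coordinate \<open>n\<close> on, and hence
  arguments on compact sets such as \<open>cube\<close>.\<close>

lemma is_poly_cong:
  assumes "is_poly n f" "\<And>i. i < n \<Longrightarrow> x i = y i"
  shows "f x = f y"
  using assms(1) by (induction rule: is_poly_induct) (auto simp: assms(2))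

lemma is_poly_continuous:
  assumes "is_poly n f"
  shows "continuous_on A f"
  using assms by (induction rule: is_poly_induct)
    (auto intro!: continuous_intros intro: continuous_on_product_coordinates
       continuous_on_subset[OF continuous_on_product_coordinates])

lemma poly_deg_le_degree:
  assumes "is_poly n f" "poly_degree n f \<le> k"
  shows "poly_deg_le n k f"
  using assms LeastI_ex[of "\<lambda>k. poly_deg_le n k f"]
  by (auto simp: is_poly_def poly_degree_def intro: poly_deg_le_mono)

text \<open>The remainder coefficients are polynomials rather than constants, which makes the
  expansion exact at every degree. Only products need work: the two expansions are multiplied out
  and regrouped.\<close>

lemma is_poly_taylor2:
  assumes "is_poly n f"
  shows "\<exists>D a. (\<forall>i j. is_poly n (a i j)) \<and>
    f = (\<lambda>x. f (\<lambda>i. 1) + (\<Sum>i<n. D i * (x i - 1)) + (\<Sum>i<n. \<Sum>j<n. a i j x * (x i - 1) * (x j - 1)))"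
  using assms
proof (induction rule: is_poly_induct)
  case (const c)
  show ?case by (intro exI[of _ "\<lambda>i. 0"] exI[of _ "\<lambda>i j x. 0"]) auto
next
  case (coord k)
  have "(\<Sum>i<n. (if i = k then 1 else 0) * (x i - 1)) = (x k - 1)" for x :: "nat \<Rightarrow> real"
  proof -
    have "(\<Sum>i<n. (if i = k then 1 else 0) * (x i - 1)) = (\<Sum>i<n. if i = k then x i - 1 else 0)"
      by (intro sum.cong) auto
    then show ?thesis using coord by simp
  qed
  then show ?case by (intro exI[of _ "\<lambda>i. if i = k then 1 else 0"] exI[of _ "\<lambda>i j x. 0"]) auto
next
  case (add f g)
  then obtain D a D' a' where a: "\<forall>i j. is_poly n (a i j)" "\<forall>i j. is_poly n (a' i j)"
    and f: "f = (\<lambda>x. f (\<lambda>i. 1) + (\<Sum>i<n. D i * (x i - 1)) + (\<Sum>i<n. \<Sum>j<n. a i j x * (x i - 1) * (x j - 1)))"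
    and g: "g = (\<lambda>x. g (\<lambda>i. 1) + (\<Sum>i<n. D' i * (x i - 1)) + (\<Sum>i<n. \<Sum>j<n. a' i j x * (x i - 1) * (x j - 1)))"
    by blast
  show ?case
  proof (intro exI[of _ "\<lambda>i. D i + D' i"] exI[of _ "\<lambda>i j x. a i j x + a' i j x"] conjI ext)
    fix x
    show "f x + g x = f (\<lambda>i. 1) + g (\<lambda>i. 1) + (\<Sum>i<n. (D i + D' i) * (x i - 1))
      + (\<Sum>i<n. \<Sum>j<n. (a i j x + a' i j x) * (x i - 1) * (x j - 1))"
      using fun_cong[OF f, of x] fun_cong[OF g, of x] by (simp add: sum.distrib distrib_right)
  qed (use a in auto)
next
  case (mult f g)
  then obtain D a D' a' where a: "\<forall>i j. is_poly n (a i j)" "\<forall>i j. is_poly n (a' i j)"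
    and f: "f = (\<lambda>x. f (\<lambda>i. 1) + (\<Sum>i<n. D i * (x i - 1)) + (\<Sum>i<n. \<Sum>j<n. a i j x * (x i - 1) * (x j - 1)))"
    and g: "g = (\<lambda>x. g (\<lambda>i. 1) + (\<Sum>i<n. D' i * (x i - 1)) + (\<Sum>i<n. \<Sum>j<n. a' i j x * (x i - 1) * (x j - 1)))"
    by blast
  define L where "L = (\<lambda>x. \<Sum>i<n. D i * (x i - 1))"
  define u where "u = f (\<lambda>i. 1)"
  define w where "w = g (\<lambda>i. 1)"
  have L: "is_poly n L" unfolding L_def by auto
  show ?case
  \<comment> \<open>With L, L' the linear parts and R, R' the remainders, f g = (u + L)(w + L' + R')
    + R g; the product L L' contributes the constants \<open>D i * D' j\<close>.\<close>
  proof (intro exI[of _ "\<lambda>i. u * D' i + w * D i"] exI[of _ "\<lambda>i j x. D i * D' j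
      + (u + L x) * a' i j x + a i j x * g x"] conjI ext allI)
    fix x
    have 1: "L x * (\<Sum>i<n. D' i * (x i - 1)) = (\<Sum>i<n. \<Sum>j<n. D i * D' j * (x i - 1) * (x j - 1))"
      unfolding L_def sum_product by (intro sum.cong refl) (simp add: algebra_simps)
    have "f x * g x = (u + L x) * (w + (\<Sum>i<n. D' i * (x i - 1)) + (\<Sum>i<n. \<Sum>j<n. a' i j x * (x i - 1) * (x j - 1)))
      + (\<Sum>i<n. \<Sum>j<n. a i j x * (x i - 1) * (x j - 1)) * g x"
      using fun_cong[OF f, of x] fun_cong[OF g, of x]
      by (simp add: L_def u_def w_def distrib_right)
    also have "\<dots> = u * w + (u * (\<Sum>i<n. D' i * (x i - 1)) + w * L x) + (L x * (\<Sum>i<n. D' i * (x i - 1))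
      + (u + L x) * (\<Sum>i<n. \<Sum>j<n. a' i j x * (x i - 1) * (x j - 1))
      + (\<Sum>i<n. \<Sum>j<n. a i j x * (x i - 1) * (x j - 1)) * g x)"
      by (simp add: algebra_simps)
    also have "u * (\<Sum>i<n. D' i * (x i - 1)) + w * L x = (\<Sum>i<n. (u * D' i + w * D i) * (x i - 1))"
      unfolding L_def by (simp add: sum_distrib_left sum.distrib[symmetric] algebra_simps)
    also have "(L x * (\<Sum>i<n. D' i * (x i - 1))
      + (u + L x) * (\<Sum>i<n. \<Sum>j<n. a' i j x * (x i - 1) * (x j - 1))
      + (\<Sum>i<n. \<Sum>j<n. a i j x * (x i - 1) * (x j - 1)) * g x)
      = (\<Sum>i<n. \<Sum>j<n. (D i * D' j + (u + L x) * a' i j x + a i j x * g x) * (x i - 1) * (x j - 1))"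
      unfolding 1 unfolding sum_distrib_left sum_distrib_right sum.distrib[symmetric]
      by (intro sum.cong refl) (simp add: algebra_simps)
    finally show "f x * g x = f (\<lambda>i. 1) * g (\<lambda>i. 1) + (\<Sum>i<n. (u * D' i + w * D i) * (x i - 1)) +
       (\<Sum>i<n. \<Sum>j<n. (D i * D' j + (u + L x) * a' i j x + a i j x * g x) * (x i - 1) * (x j - 1))"
      by (simp add: u_def w_def)
  qed (use a L mult in auto)
qed

section \<open>Compactness and quadratic forms\<close>

text \<open>On the compact set where p \<le> 0, q has a positive minimum, so a large multiple of q
  outweighs p; elsewhere p is already positive. Compactness then gives the uniform margin. Each
  enlargement of a region of positivity below relies on this.\<close>

lemma compact_penalty:
  fixes p q :: "'a::t2_space \<Rightarrow> real"
  assumes X: "compact X" and p: "continuous_on X p" and q: "continuous_on X q"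
    and q0: "\<And>x. x \<in> X \<Longrightarrow> 0 \<le> q x"
    and pos: "\<And>x. x \<in> X \<Longrightarrow> q x = 0 \<Longrightarrow> 0 < p x"
  obtains C \<eta> where "0 \<le> C" "0 < \<eta>" "\<And>x. x \<in> X \<Longrightarrow> \<eta> \<le> p x + C * q x"
proof -
  have "\<exists>C\<ge>0. \<forall>x\<in>X. 0 < p x + C * q x"
  proof -
    define Z where "Z = X \<inter> (X \<inter> p -` {..0})"
    have Z: "compact Z" unfolding Z_def
      by (intro compact_Int_closed X continuous_closed_preimage p compact_imp_closed closed_atMost)
    have ZX: "Z \<subseteq> X" by (auto simp: Z_def)
    show ?thesis
    proof (cases "Z = {}")
      case True
      then have "\<forall>x\<in>X. 0 < p x" by (fastforce simp: Z_def)
      then show ?thesis by (intro exI[of _ 0]) auto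
    next
      case False
      obtain z where z: "z \<in> Z" "\<And>x. x \<in> Z \<Longrightarrow> q z \<le> q x"
        using continuous_attains_inf[OF Z False continuous_on_subset[OF q ZX]] by blast
      obtain w where w: "w \<in> Z" "\<And>x. x \<in> Z \<Longrightarrow> p w \<le> p x"
        using continuous_attains_inf[OF Z False continuous_on_subset[OF p ZX]] by blast
      have qz: "q z > 0"
        using z(1) q0[of z] pos[of z] ZX by (fastforce simp: Z_def)
      define C where "C = (1 + \<bar>p w\<bar>) / q z"
      have C: "C > 0" using qz by (auto simp: C_def)
      have "0 < p x + C * q x" if x: "x \<in> X" for x
      proof (cases "x \<in> Z")
        case True
        have "1 + \<bar>p w\<bar> = C * q z" using qz by (simp add: C_def)
        also have "\<dots> \<le> C * q x" using C z(2)[OF True] by simp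
        finally show ?thesis using w(2)[OF True] by linarith
      next
        case False
        then have "p x > 0" using x by (auto simp: Z_def)
        then show ?thesis using C q0[OF x] by (simp add: add_pos_nonneg)
      qed
      then show ?thesis using C by (intro exI[of _ C]) auto
    qed
  qed
  then obtain C where C: "C \<ge> 0" "\<And>x. x \<in> X \<Longrightarrow> 0 < p x + C * q x" by blast
  show ?thesis
  proof (cases "X = {}")
    case True
    then show ?thesis using that[of 0 1] by auto
  next
    case False
    have "continuous_on X (\<lambda>x. p x + C * q x)" by (intro continuous_intros p q)
    then obtain z where "z \<in> X" "\<And>x. x \<in> X \<Longrightarrow> p z + C * q z \<le> p x + C * q x"
      using continuous_attains_inf[OF X False] by blast
    then show ?thesis using that C by blast
  qed
qed

text \<open>Fixing the coordinates from \<open>n\<close> on to 0 makes this a product of compact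
  sets, hence compact in the product topology by Tychonoff.\<close>

definition cube :: "nat \<Rightarrow> real \<Rightarrow> (nat \<Rightarrow> real) set" where
  "cube n N = {x. (\<forall>i<n. \<bar>x i\<bar> \<le> N) \<and> (\<forall>i\<ge>n. x i = 0)}"

lemma compact_cube: "compact (cube n N)"
proof -
  have "cube n N = PiE UNIV (\<lambda>i. if i < n then {-N..N} else {0})"
    by (auto simp: cube_def PiE_iff abs_le_iff split: if_splits) (metis minus_le_iff)+
  moreover have "compactin (product_topology (\<lambda>i. euclidean) UNIV)
      (PiE UNIV (\<lambda>i. if i < n then {-N..N} else {0}))"
    unfolding compactin_PiE by auto
  ultimately show ?thesis by (simp add: euclidean_product_topology)
qed

text \<open>Completing the square in the last variable: the pivot is positive and the Schur
  complement \<open>a'\<close> is again positive definite, so induction applies.\<close>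

lemma quadratic_form_sum_squares:
  fixes a :: "nat \<Rightarrow> nat \<Rightarrow> real"
  assumes "\<And>v. \<exists>i<n. v i \<noteq> 0 \<Longrightarrow> 0 < (\<Sum>i<n. \<Sum>j<n. a i j * v i * v j)"
  shows "\<exists>ls. \<forall>v. (\<Sum>i<n. \<Sum>j<n. a i j * v i * v j) = (\<Sum>l\<leftarrow>ls. (\<Sum>i<n. l i * v i)\<^sup>2)"
  using assms
proof (induction n arbitrary: a)
  case 0
  show ?case by (intro exI[of _ "[]"]) auto
next
  case (Suc n)
  define r where "r = a n n"
  \<comment> \<open>The entries of the last row and column are averaged because \<open>a\<close>
    need not be symmetric.\<close>
  define b where "b = (\<lambda>i. (a i n + a n i) / 2)"
  define a' where "a' = (\<lambda>i j. a i j - b i * b j / r)"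
  have r: "r > 0"
    using Suc.prems[of "\<lambda>i. if i = n then 1 else 0"] by (simp add: r_def)
  have split: "(\<Sum>i<Suc n. \<Sum>j<Suc n. a i j * v i * v j)
      = r * (v n + (\<Sum>i<n. b i * v i) / r)\<^sup>2 + (\<Sum>i<n. \<Sum>j<n. a' i j * v i * v j)" for v :: "nat \<Rightarrow> real"
  proof -
    have 1: "(\<Sum>i<n. \<Sum>j<n. a' i j * v i * v j)
        = (\<Sum>i<n. \<Sum>j<n. a i j * v i * v j) - (\<Sum>i<n. b i * v i)\<^sup>2 / r"
    proof -
      have "(\<Sum>i<n. b i * v i)\<^sup>2 / r = (\<Sum>i<n. \<Sum>j<n. b i * b j / r * v i * v j)"
        unfolding power2_eq_square sum_product sum_divide_distrib
        by (intro sum.cong refl) (simp add: field_simps)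
      then show ?thesis unfolding a'_def
        by (simp add: left_diff_distrib sum_subtractf)
    qed
    have 2: "(\<Sum>i<n. a i n * v i * v n) + (\<Sum>j<n. a n j * v n * v j) = 2 * v n * (\<Sum>i<n. b i * v i)"
      unfolding b_def sum_distrib_left sum.distrib[symmetric]
      by (intro sum.cong refl) (simp add: field_simps)
    have "(\<Sum>i<Suc n. \<Sum>j<Suc n. a i j * v i * v j) = (\<Sum>i<n. \<Sum>j<n. a i j * v i * v j)
        + ((\<Sum>i<n. a i n * v i * v n) + (\<Sum>j<n. a n j * v n * v j)) + r * (v n)\<^sup>2"
      by (simp add: sum.distrib r_def power2_eq_square algebra_simps)
    also have "\<dots> = r * (v n + (\<Sum>i<n. b i * v i) / r)\<^sup>2 + (\<Sum>i<n. \<Sum>j<n. a' i j * v i * v j)"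
      unfolding 1 2 using r by (simp add: power2_eq_square field_simps)
    finally show ?thesis .
  qed
  have "0 < (\<Sum>i<n. \<Sum>j<n. a' i j * v i * v j)" if v: "\<exists>i<n. v i \<noteq> 0" for v :: "nat \<Rightarrow> real"
  proof -
    \<comment> \<open>This last coordinate annihilates the completed square and leaves only the form
      of \<open>a'\<close>.\<close>
    define w where "w = (\<lambda>i. if i = n then - (\<Sum>i<n. b i * v i) / r else v i)"
    have "\<exists>i<Suc n. w i \<noteq> 0" using v by (auto simp: w_def)
    then have "0 < (\<Sum>i<Suc n. \<Sum>j<Suc n. a i j * w i * w j)" by (rule Suc.prems)
    also have "\<dots> = (\<Sum>i<n. \<Sum>j<n. a' i j * v i * v j)"
      unfolding split by (simp add: w_def)
    finally show ?thesis .
  qed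
  from Suc.IH[OF this] obtain ls where
    ls: "\<And>v. (\<Sum>i<n. \<Sum>j<n. a' i j * v i * v j) = (\<Sum>l\<leftarrow>ls. (\<Sum>i<n. l i * v i)\<^sup>2)" by blast
  define l0 where "l0 = (\<lambda>i. sqrt r * (if i = n then 1 else b i / r))"
  have l0: "(\<Sum>i<Suc n. l0 i * v i)\<^sup>2 = r * (v n + (\<Sum>i<n. b i * v i) / r)\<^sup>2" for v
  proof -
    have "(\<Sum>i<Suc n. l0 i * v i) = sqrt r * (v n + (\<Sum>i<n. b i * v i) / r)"
      by (simp add: l0_def sum_distrib_left sum_divide_distrib algebra_simps)
    then show ?thesis using r by (simp add: power_mult_distrib)
  qed
  show ?case
  proof (intro exI[of _ "l0 # map (\<lambda>l i. if i = n then 0 else l i) ls"] allI)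
    fix v
    have "(\<Sum>l\<leftarrow>map (\<lambda>l i. if i = n then 0 else l i) ls. (\<Sum>i<Suc n. l i * v i)\<^sup>2)
        = (\<Sum>l\<leftarrow>ls. (\<Sum>i<n. l i * v i)\<^sup>2)"
      by (simp add: o_def)
    then show "(\<Sum>i<Suc n. \<Sum>j<Suc n. a i j * v i * v j) =
       (\<Sum>l\<leftarrow>l0 # map (\<lambda>l i. if i = n then 0 else l i) ls. (\<Sum>i<Suc n. l i * v i)\<^sup>2)"
      unfolding split ls by (simp only: list.map sum_list.Cons l0)
  qed
qed

section \<open>Bernstein expansion of polynomials\<close>

text \<open>By binom(m,k) binom(k,j) = binom(m,j) binom(m-j,k-j), the right side is u^j times the
  Bernstein partition of unity of degree m - j.\<close>

lemma power_eq_sum_Bernstein: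
  assumes "j \<le> m"
  shows "u ^ j = (\<Sum>k\<le>m. (real (k choose j) / real (m choose j)) * Bernstein m k u)"
proof -
  have "(\<Sum>k\<le>m. (real (k choose j) / real (m choose j)) * Bernstein m k u)
      = (\<Sum>k\<in>{j..m}. (real (k choose j) / real (m choose j)) * Bernstein m k u)"
    by (intro sum.mono_neutral_right) auto
  also have "\<dots> = (\<Sum>l\<le>m - j. (real ((l + j) choose j) / real (m choose j)) * Bernstein m (l + j) u)"
    using assms by (intro sum.reindex_bij_witness[of _ "\<lambda>l. l + j" "\<lambda>k. k - j"]) auto
  also have "\<dots> = (\<Sum>l\<le>m - j. u ^ j * Bernstein (m - j) l u)"
  proof (intro sum.cong refl)
    fix l assume "l \<in> {..m - j}"
    then have l: "l + j \<le> m" using assms by auto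
    have "real (m choose (l + j)) * real ((l + j) choose j) = real (m choose j) * real ((m - j) choose l)"
      using choose_mult[of j "l + j" m] l by (metis add_diff_cancel_right' le_add2 of_nat_mult)
    moreover have "real (m choose j) \<noteq> 0" using assms by simp
    moreover have "m - (l + j) = m - j - l" by simp
    ultimately show "(real ((l + j) choose j) / real (m choose j)) * Bernstein m (l + j) u
        = u ^ j * Bernstein (m - j) l u"
      unfolding Bernstein_def by (simp add: power_add field_simps)
  qed
  also have "\<dots> = u ^ j" by (simp add: sum_distrib_left[symmetric])
  finally show ?thesis ..
qed

text \<open>The quotient of binomials is a product of \<open>j\<close> factors (k - l)/(m - l), each
  within j/(m - j) of k/m, and products of numbers of modulus at most 1 differ by at most the sum of
  the differences. The condition 2 j < m bounds the modulus by 1 even when k < l.\<close>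

lemma Bernstein_coefficient_bound:
  assumes m: "2 * j < m" and k: "k \<le> m"
  shows "\<bar>real (k choose j) / real (m choose j) - (real k / real m) ^ j\<bar> \<le> real j * real j / real (m - j)"
proof -
  have eq: "real (k choose j) / real (m choose j) = (\<Prod>l<j. (real k - real l) / (real m - real l))"
    by (simp add: binomial_gbinomial gbinomial_prod_rev prod_dividef atLeast0LessThan)
  have "norm ((\<Prod>l<j. (real k - real l) / (real m - real l)) - (\<Prod>l<j. real k / real m))
      \<le> (\<Sum>l<j. norm ((real k - real l) / (real m - real l) - real k / real m))"
    using m k by (intro norm_prod_diff) (auto simp: abs_if field_simps)
  also have "\<dots> \<le> (\<Sum>l<j. real j / real (m - j))"
  proof (intro sum_mono)
    fix l assume "l \<in> {..<j}"
    then have l: "l < j" by simp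
    have "(real k - real l) / (real m - real l) - real k / real m
        = - (real l * ((real m - real k) / real m) / (real m - real l))"
      using m l by (simp add: field_simps)
    also have "norm \<dots> = real l * ((real m - real k) / real m) / (real m - real l)"
      using m l k by simp
    also have "\<dots> \<le> real j * 1 / real (m - j)"
      using m l k by (intro frac_le mult_mono) (auto simp: field_simps of_nat_diff)
    finally show "norm ((real k - real l) / (real m - real l) - real k / real m) \<le> real j / real (m - j)"
      by simp
  qed
  finally show ?thesis unfolding eq by simp
qed

lemma Bernstein_coefficients_converge:
  assumes "0 < e"
  shows "\<forall>\<^sub>F m in sequentially. \<forall>k\<le>m.
    \<bar>real (k choose j) / real (m choose j) - (real k / real m) ^ j\<bar> \<le> e"
proof -
  obtain M where M: "real j * real j / e < real M" using reals_Archimedean2 by blast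
  show ?thesis
  proof (rule eventually_mono[OF eventually_gt_at_top[of "2 * j + M"]], intro allI impI)
    fix m k assume m: "2 * j + M < m" and k: "k \<le> m"
    then have "\<bar>real (k choose j) / real (m choose j) - (real k / real m) ^ j\<bar> \<le> real j * real j / real (m - j)"
      by (intro Bernstein_coefficient_bound) auto
    also have "\<dots> \<le> e"
    proof -
      have "real j * real j < real M * e" using M assms by (simp add: field_simps)
      also have "\<dots> \<le> real (m - j) * e" using m assms by (intro mult_right_mono) auto
      finally show ?thesis using m by (simp add: field_simps)
    qed
    finally show "\<bar>real (k choose j) / real (m choose j) - (real k / real m) ^ j\<bar> \<le> e" .
  qed
qed

text \<open>The coefficients are products of univariate ones; all factors have modulus at most 1, so
  the errors add up over the \<open>n\<close> variables.\<close>

lemma Bernstein_monom: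
  assumes "0 < e"
  shows "\<forall>\<^sub>F m in sequentially. \<exists>c. 
    (\<forall>u. monom_eval n a u = (\<Sum>K\<in>PiE {..<n} (\<lambda>_. {..m}). c K * (\<Prod>i<n. Bernstein m (K i) (u i)))) \<and>
    (\<forall>K\<in>PiE {..<n} (\<lambda>_. {..m}). \<bar>c K - monom_eval n a (\<lambda>i. real (K i) / real m)\<bar> \<le> e)"
proof -
  \<comment> \<open>The errors of the \<open>n\<close> factors then sum to at most \<open>e\<close>;
    the extra 1 covers n = 0.\<close>
  define e' where "e' = e / (real n + 1)"
  have e': "e' > 0" using assms by (simp add: e'_def)
  have "\<forall>\<^sub>F m in sequentially. \<forall>i\<in>{..<n}. a i \<le> m \<and> (\<forall>k\<le>m.
    \<bar>real (k choose a i) / real (m choose a i) - (real k / real m) ^ a i\<bar> \<le> e')"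
    by (intro eventually_ball_finite ballI eventually_conj Bernstein_coefficients_converge e'
        eventually_ge_at_top) auto
  then show ?thesis
  proof (rule eventually_mono)
    fix m assume m: "\<forall>i\<in>{..<n}. a i \<le> m \<and> (\<forall>k\<le>m.
      \<bar>real (k choose a i) / real (m choose a i) - (real k / real m) ^ a i\<bar> \<le> e')"
    define c where "c = (\<lambda>K. \<Prod>i<n. real (K i choose a i) / real (m choose a i))"
    have "monom_eval n a u = (\<Sum>K\<in>PiE {..<n} (\<lambda>_. {..m}). c K * (\<Prod>i<n. Bernstein m (K i) (u i)))" for u
    proof -
      have "monom_eval n a u = (\<Prod>i<n. \<Sum>k\<le>m. (real (k choose a i) / real (m choose a i)) * Bernstein m k (u i))"
        unfolding monom_eval_def using m by (intro prod.cong refl power_eq_sum_Bernstein) auto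
      also have "\<dots> = (\<Sum>K\<in>PiE {..<n} (\<lambda>_. {..m}). \<Prod>i<n. (real (K i choose a i) / real (m choose a i)) * Bernstein m (K i) (u i))"
        by (intro prod_sum_PiE) auto
      finally show ?thesis by (simp only: prod.distrib c_def)
    qed
    moreover have "\<bar>c K - monom_eval n a (\<lambda>i. real (K i) / real m)\<bar> \<le> e"
      if K: "K \<in> PiE {..<n} (\<lambda>_. {..m})" for K
    proof -
      have Ki: "K i \<le> m" if "i < n" for i using K that by (auto simp: PiE_iff)
      have "norm (c K - monom_eval n a (\<lambda>i. real (K i) / real m))
        \<le> (\<Sum>i<n. norm (real (K i choose a i) / real (m choose a i) - (real (K i) / real m) ^ a i))"
        unfolding c_def monom_eval_def
      proof (intro norm_prod_diff)
        fix i assume "i \<in> {..<n}"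
        then have i: "K i \<le> m" "a i \<le> m" using Ki m by auto
        show "norm (real (K i choose a i) / real (m choose a i)) \<le> 1"
          using i binomial_right_mono[of "K i" m "a i"] by (simp add: field_simps)
        show "norm ((real (K i) / real m) ^ a i) \<le> 1"
          using power_le_one[of "real (K i) / real m" "a i"] i
          by (cases "m = 0") (auto simp: power_divide)
      qed
      also have "\<dots> \<le> (\<Sum>i<n. e')"
        using m Ki by (intro sum_mono) auto
      also have "\<dots> \<le> e" using assms by (simp add: e'_def field_simps)
      finally show ?thesis by simp
    qed
    ultimately show "\<exists>c. (\<forall>u. monom_eval n a u = (\<Sum>K\<in>PiE {..<n} (\<lambda>_. {..m}). c K * (\<Prod>i<n. Bernstein m (K i) (u i)))) \<and>
      (\<forall>K\<in>PiE {..<n} (\<lambda>_. {..m}). \<bar>c K - monom_eval n a (\<lambda>i. real (K i) / real m)\<bar> \<le> e)"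
      by (intro exI[of _ c]) auto
  qed
qed

text \<open>The coefficients approach the values at grid nodes of the cube uniformly, so strict
  positivity on the cube can be passed on to them. An affine substitution reduces to the unit cube,
  linearity to monomials.\<close>

lemma Bernstein_poly:
  assumes f: "is_poly n f" and N: "0 < N" and e: "0 < e"
  shows "\<forall>\<^sub>F m in sequentially. \<exists>c. 
    (\<forall>x. f x = (\<Sum>K\<in>PiE {..<n} (\<lambda>_. {..m}). c K * (\<Prod>i<n. Bernstein m (K i) ((N + x i) / (2 * N))))) \<and>
    (\<forall>K\<in>PiE {..<n} (\<lambda>_. {..m}). \<bar>c K - f (\<lambda>i. N * (2 * (real (K i) / real m) - 1))\<bar> \<le> e)"
proof -
  define g where "g = (\<lambda>u. f (\<lambda>i. N * (2 * u i - 1)))"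
  have "is_poly n g" unfolding g_def by (rule is_poly_compose[OF f]) auto
  then obtain k d where g: "g = (\<lambda>x. \<Sum>a\<in>monomials_le n k. d a * monom_eval n a x)"
    by (auto simp: is_poly_def poly_deg_le_def)
  define e' where "e' = e / ((\<Sum>a\<in>monomials_le n k. \<bar>d a\<bar>) + 1)"
  have S0: "(\<Sum>a\<in>monomials_le n k. \<bar>d a\<bar>) \<ge> 0" by (intro sum_nonneg) auto
  have e': "e' > 0" unfolding e'_def using e S0 by (intro divide_pos_pos add_nonneg_pos) auto
  have "\<forall>\<^sub>F m in sequentially. \<forall>a\<in>monomials_le n k. \<exists>c. 
    (\<forall>u. monom_eval n a u = (\<Sum>K\<in>PiE {..<n} (\<lambda>_. {..m}). c K * (\<Prod>i<n. Bernstein m (K i) (u i)))) \<and>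
    (\<forall>K\<in>PiE {..<n} (\<lambda>_. {..m}). \<bar>c K - monom_eval n a (\<lambda>i. real (K i) / real m)\<bar> \<le> e')"
    by (intro eventually_ball_finite ballI Bernstein_monom e' finite_monomials_le)
  then show ?thesis
  proof (rule eventually_mono)
    fix m assume "\<forall>a\<in>monomials_le n k. \<exists>c. 
      (\<forall>u. monom_eval n a u = (\<Sum>K\<in>PiE {..<n} (\<lambda>_. {..m}). c K * (\<Prod>i<n. Bernstein m (K i) (u i)))) \<and>
      (\<forall>K\<in>PiE {..<n} (\<lambda>_. {..m}). \<bar>c K - monom_eval n a (\<lambda>i. real (K i) / real m)\<bar> \<le> e')"
    from bchoice[OF this] obtain C where C: "\<forall>a\<in>monomials_le n k.
      (\<forall>u. monom_eval n a u = (\<Sum>K\<in>PiE {..<n} (\<lambda>_. {..m}). C a K * (\<Prod>i<n. Bernstein m (K i) (u i)))) \<and>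
      (\<forall>K\<in>PiE {..<n} (\<lambda>_. {..m}). \<bar>C a K - monom_eval n a (\<lambda>i. real (K i) / real m)\<bar> \<le> e')"
      by blast
    have C1: "monom_eval n a u = (\<Sum>K\<in>PiE {..<n} (\<lambda>_. {..m}). C a K * (\<Prod>i<n. Bernstein m (K i) (u i)))"
      if "a \<in> monomials_le n k" for a u
      using C that by blast
    have C2: "\<bar>C a K - monom_eval n a (\<lambda>i. real (K i) / real m)\<bar> \<le> e'"
      if "a \<in> monomials_le n k" "K\<in>PiE {..<n} (\<lambda>_. {..m})" for a K
      using C that by blast
    define c where "c = (\<lambda>K. \<Sum>a\<in>monomials_le n k. d a * C a K)"
    have "f x = (\<Sum>K\<in>PiE {..<n} (\<lambda>_. {..m}). c K * (\<Prod>i<n. Bernstein m (K i) ((N + x i) / (2 * N))))" for x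
    proof -
      have "f x = g (\<lambda>i. (N + x i) / (2 * N))"
        using N by (simp add: g_def field_simps)
      also have "\<dots> = (\<Sum>a\<in>monomials_le n k. d a * (\<Sum>K\<in>PiE {..<n} (\<lambda>_. {..m}). C a K * (\<Prod>i<n. Bernstein m (K i) ((N + x i) / (2 * N)))))"
        unfolding g by (intro sum.cong refl) (simp add: C1)
      also have "\<dots> = (\<Sum>K\<in>PiE {..<n} (\<lambda>_. {..m}). \<Sum>a\<in>monomials_le n k. d a * C a K * (\<Prod>i<n. Bernstein m (K i) ((N + x i) / (2 * N))))"
        unfolding sum_distrib_left by (subst sum.swap) (simp add: mult.assoc)
      finally show ?thesis by (simp add: c_def sum_distrib_right)
    qed
    moreover have "\<bar>c K - f (\<lambda>i. N * (2 * (real (K i) / real m) - 1))\<bar> \<le> e"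
      if K: "K \<in> PiE {..<n} (\<lambda>_. {..m})" for K
    proof -
      have "f (\<lambda>i. N * (2 * (real (K i) / real m) - 1)) = g (\<lambda>i. real (K i) / real m)"
        by (simp add: g_def)
      then have "\<bar>c K - f (\<lambda>i. N * (2 * (real (K i) / real m) - 1))\<bar>
        = \<bar>\<Sum>a\<in>monomials_le n k. d a * (C a K - monom_eval n a (\<lambda>i. real (K i) / real m))\<bar>"
        unfolding g c_def by (simp add: sum_subtractf right_diff_distrib)
      also have "\<dots> \<le> (\<Sum>a\<in>monomials_le n k. \<bar>d a\<bar> * e')"
        using C2[OF _ K] by (intro order.trans[OF sum_abs] sum_mono) (auto simp: abs_mult intro: mult_left_mono)
      also have "\<dots> = (\<Sum>a\<in>monomials_le n k. \<bar>d a\<bar>) * e'" by (simp add: sum_distrib_right)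
      also have "\<dots> \<le> ((\<Sum>a\<in>monomials_le n k. \<bar>d a\<bar>) + 1) * e'" using e' by (simp add: distrib_right)
      also have "\<dots> = e" unfolding e'_def using S0 by (intro nonzero_mult_div_cancel_left[of _ e, folded times_divide_eq_right]) linarith
      finally show ?thesis .
    qed
    ultimately show "\<exists>c. (\<forall>x. f x = (\<Sum>K\<in>PiE {..<n} (\<lambda>_. {..m}). c K * (\<Prod>i<n. Bernstein m (K i) ((N + x i) / (2 * N))))) \<and>
      (\<forall>K\<in>PiE {..<n} (\<lambda>_. {..m}). \<bar>c K - f (\<lambda>i. N * (2 * (real (K i) / real m) - 1))\<bar> \<le> e)"
      by (intro exI[of _ c]) auto
  qed
qed

section \<open>Sums of squares modulo the sphere\<close>

text \<open>Degrees are ignored during the construction and restored at the end: a certificate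
  involves finitely many polynomials, so it fits every sufficiently large degree.\<close>

definition poly_sos :: "nat \<Rightarrow> ((nat \<Rightarrow> real) \<Rightarrow> real) \<Rightarrow> bool" where
  "poly_sos n f \<longleftrightarrow> (\<exists>gs. (\<forall>g\<in>set gs. is_poly n g) \<and> f = (\<lambda>x. \<Sum>g\<leftarrow>gs. (g x)\<^sup>2))"

lemma poly_sos_imp_sos:
  assumes "poly_sos n f"
  shows "\<forall>\<^sub>F d in sequentially. sos n d f"
proof -
  from assms obtain gs where gs: "\<forall>g\<in>set gs. is_poly n g" "f = (\<lambda>x. \<Sum>g\<leftarrow>gs. (g x)\<^sup>2)"
    by (auto simp: poly_sos_def)
  have "\<forall>\<^sub>F d in sequentially. poly_deg_le n d g" if g: "g \<in> set gs" for g
  proof -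
    obtain k where "poly_deg_le n k g" using gs g by (auto simp: is_poly_def)
    then show ?thesis by (auto simp: eventually_sequentially intro: poly_deg_le_mono)
  qed
  then have "\<forall>\<^sub>F d in sequentially. \<forall>g\<in>set gs. poly_deg_le n d g"
    by (intro eventually_ball_finite) auto
  then show ?thesis by (rule eventually_mono) (auto simp: sos_def gs(2))
qed

lemma poly_sos_is_poly: "poly_sos n f \<Longrightarrow> is_poly n f"
proof -
  have "is_poly n (\<lambda>x. \<Sum>g\<leftarrow>gs. (g x)\<^sup>2)" if "\<forall>g\<in>set gs. is_poly n g" for gs
    using that by (induction gs) auto
  then show "poly_sos n f \<Longrightarrow> is_poly n f" by (auto simp: poly_sos_def)
qed

lemma poly_sos_square: "is_poly n g \<Longrightarrow> poly_sos n (\<lambda>x. (g x)\<^sup>2)"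
  unfolding poly_sos_def by (intro exI[of _ "[g]"]) auto

lemma poly_sos_const: "0 \<le> c \<Longrightarrow> poly_sos n (\<lambda>x. c)"
  using poly_sos_square[of n "\<lambda>x. sqrt c"] by auto

lemma poly_sos_add:
  assumes "poly_sos n f" "poly_sos n g" shows "poly_sos n (\<lambda>x. f x + g x)"
proof -
  from assms obtain fs gs where "\<forall>g\<in>set fs. is_poly n g" "f = (\<lambda>x. \<Sum>g\<leftarrow>fs. (g x)\<^sup>2)"
    "\<forall>g\<in>set gs. is_poly n g" "g = (\<lambda>x. \<Sum>g\<leftarrow>gs. (g x)\<^sup>2)"
    by (auto simp: poly_sos_def)
  then show ?thesis unfolding poly_sos_def by (intro exI[of _ "fs @ gs"]) auto
qed

lemma poly_sos_sum:
  "(\<And>i. i \<in> I \<Longrightarrow> poly_sos n (f i)) \<Longrightarrow> poly_sos n (\<lambda>x. \<Sum>i\<in>I. f i x)"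
  by (induction I rule: infinite_finite_induct) (auto intro: poly_sos_const poly_sos_add)

lemma poly_sos_sum_list:
  "(\<And>l. l \<in> set ls \<Longrightarrow> poly_sos n (f l)) \<Longrightarrow> poly_sos n (\<lambda>x. \<Sum>l\<leftarrow>ls. f l x)"
  by (induction ls) (auto intro: poly_sos_const poly_sos_add)

lemma poly_sos_mult:
  assumes "poly_sos n f" "poly_sos n g" shows "poly_sos n (\<lambda>x. f x * g x)"
proof -
  from assms obtain fs gs where fs: "\<forall>g\<in>set fs. is_poly n g" "f = (\<lambda>x. \<Sum>g\<leftarrow>fs. (g x)\<^sup>2)"
    and gs: "\<forall>g\<in>set gs. is_poly n g" "g = (\<lambda>x. \<Sum>g\<leftarrow>gs. (g x)\<^sup>2)"
    by (auto simp: poly_sos_def)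
  have "f x * g x = (\<Sum>u\<leftarrow>fs. \<Sum>w\<leftarrow>gs. (u x * w x)\<^sup>2)" for x
    by (simp add: fs(2) gs(2) sum_list_mult_const sum_list_const_mult power_mult_distrib)
  then have "(\<lambda>x. f x * g x) = (\<lambda>x. \<Sum>u\<leftarrow>fs. \<Sum>w\<leftarrow>gs. (u x * w x)\<^sup>2)" by auto
  then show ?thesis using fs gs by (auto intro!: poly_sos_sum_list poly_sos_square)
qed

lemma is_poly_norm_pi_sq: "(\<And>i. i < n \<Longrightarrow> is_poly n (y i)) \<Longrightarrow> is_poly n (\<lambda>x. norm_pi_sq n \<pi> (\<lambda>i. y i x))"
  unfolding norm_pi_sq_def by auto

text \<open>Sums of squares in the quotient by the sphere equation, without the multipliers x_i.
  This class is closed under products, as the multivariate Bernstein polynomials require.\<close>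

definition sos_mod :: "nat \<Rightarrow> (nat \<Rightarrow> real) \<Rightarrow> ((nat \<Rightarrow> real) \<Rightarrow> real) \<Rightarrow> bool" where
  "sos_mod n \<pi> f \<longleftrightarrow> (\<exists>\<sigma> \<phi>. poly_sos n \<sigma> \<and> is_poly n \<phi> \<and>
     f = (\<lambda>x. \<sigma> x + \<phi> x * (norm_pi_sq n \<pi> x - 1)))"

lemma sos_modI:
  "poly_sos n \<sigma> \<Longrightarrow> is_poly n \<phi> \<Longrightarrow> (\<And>x. f x = \<sigma> x + \<phi> x * (norm_pi_sq n \<pi> x - 1)) \<Longrightarrow> sos_mod n \<pi> f"
  unfolding sos_mod_def by blast

lemma sos_mod_sos: "poly_sos n f \<Longrightarrow> sos_mod n \<pi> f"
  by (rule sos_modI[of n f "\<lambda>x. 0"]) auto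

lemma sos_mod_const: "0 \<le> c \<Longrightarrow> sos_mod n \<pi> (\<lambda>x. c)"
  by (intro sos_mod_sos poly_sos_const)

lemma sos_mod_add:
  assumes "sos_mod n \<pi> f" "sos_mod n \<pi> g" shows "sos_mod n \<pi> (\<lambda>x. f x + g x)"
proof -
  from assms obtain \<sigma> \<phi> \<sigma>' \<phi>' where *: "poly_sos n \<sigma>" "is_poly n \<phi>" "poly_sos n \<sigma>'" "is_poly n \<phi>'"
     "f = (\<lambda>x. \<sigma> x + \<phi> x * (norm_pi_sq n \<pi> x - 1))" "g = (\<lambda>x. \<sigma>' x + \<phi>' x * (norm_pi_sq n \<pi> x - 1))"
    unfolding sos_mod_def by blast
  show ?thesis
    by (rule sos_modI[of n "\<lambda>x. \<sigma> x + \<sigma>' x" "\<lambda>x. \<phi> x + \<phi>' x"])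
      (use * in \<open>auto intro: poly_sos_add simp: algebra_simps\<close>)
qed

lemma sos_mod_mult:
  assumes "sos_mod n \<pi> f" "sos_mod n \<pi> g" shows "sos_mod n \<pi> (\<lambda>x. f x * g x)"
proof -
  from assms obtain \<sigma> \<phi> \<sigma>' \<phi>' where *: "poly_sos n \<sigma>" "is_poly n \<phi>" "poly_sos n \<sigma>'" "is_poly n \<phi>'"
     "f = (\<lambda>x. \<sigma> x + \<phi> x * (norm_pi_sq n \<pi> x - 1))" "g = (\<lambda>x. \<sigma>' x + \<phi>' x * (norm_pi_sq n \<pi> x - 1))"
    unfolding sos_mod_def by blast
  show ?thesis
    by (rule sos_modI[of n "\<lambda>x. \<sigma> x * \<sigma>' x"
        "\<lambda>x. \<sigma> x * \<phi>' x + \<phi> x * \<sigma>' x + \<phi> x * \<phi>' x * (norm_pi_sq n \<pi> x - 1)"])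
      (use * in \<open>auto intro: poly_sos_mult is_poly_norm_pi_sq poly_sos_is_poly simp: algebra_simps\<close>)
qed

lemma sos_mod_sum:
  "(\<And>i. i \<in> I \<Longrightarrow> sos_mod n \<pi> (f i)) \<Longrightarrow> sos_mod n \<pi> (\<lambda>x. \<Sum>i\<in>I. f i x)"
  by (induction I rule: infinite_finite_induct) (auto intro: sos_mod_const sos_mod_add)

lemma sos_mod_prod:
  "(\<And>i. i \<in> I \<Longrightarrow> sos_mod n \<pi> (f i)) \<Longrightarrow> sos_mod n \<pi> (\<lambda>x. \<Prod>i\<in>I. f i x)"
  by (induction I rule: infinite_finite_induct) (auto intro: sos_mod_const sos_mod_mult)

lemma sos_mod_power: "sos_mod n \<pi> f \<Longrightarrow> sos_mod n \<pi> (\<lambda>x. f x ^ k)"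
  by (induction k) (auto intro: sos_mod_const sos_mod_mult)

text \<open>On the sphere, \<open>2 N (N + c x\<^sub>i) = (N + c x\<^sub>i)\<^sup>2 + (N\<^sup>2 \<parallel>x\<parallel>\<^sup>2 - x\<^sub>i\<^sup>2)\<close> for \<open>c = \<plusminus>1\<close>.\<close>
lemma sos_mod_affine:
  assumes N: "0 < N" "\<And>i. i < n \<Longrightarrow> 1 \<le> N\<^sup>2 * \<pi> i" and i: "i < n" and c: "c\<^sup>2 = 1"
  shows "sos_mod n \<pi> (\<lambda>x. N + c * x i)"
proof (rule sos_modI)
  let ?r = "\<lambda>x. 1 / (2 * N) * ((N + c * x i)\<^sup>2 + (\<Sum>j<n. (N\<^sup>2 * \<pi> j - (if j = i then 1 else 0)) * (x j)\<^sup>2))"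
  show "poly_sos n ?r"
  proof (intro poly_sos_mult poly_sos_add poly_sos_sum poly_sos_const poly_sos_square)
    fix j assume "j \<in> {..<n}"
    then show "0 \<le> N\<^sup>2 * \<pi> j - (if j = i then 1 else 0)" using N(2)[of j] by auto
  qed (use N i in auto)
  show "is_poly n (\<lambda>x. - (N / 2))" by auto
  fix x :: "nat \<Rightarrow> real"
  have "(\<Sum>j<n. (N\<^sup>2 * \<pi> j - (if j = i then 1 else 0)) * (x j)\<^sup>2)
      = N\<^sup>2 * norm_pi_sq n \<pi> x - (\<Sum>j<n. if j = i then (x j)\<^sup>2 else 0)"
    unfolding norm_pi_sq_def sum_distrib_left sum_subtractf[symmetric]
    by (intro sum.cong refl) (simp add: algebra_simps)
  also have "(\<Sum>j<n. if j = i then (x j)\<^sup>2 else 0) = (x i)\<^sup>2" using i by simp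
  finally have *: "(\<Sum>j<n. (N\<^sup>2 * \<pi> j - (if j = i then 1 else 0)) * (x j)\<^sup>2) = N\<^sup>2 * norm_pi_sq n \<pi> x - (x i)\<^sup>2" .
  have "(N + c * x i)\<^sup>2 = N\<^sup>2 + 2 * N * c * x i + (x i)\<^sup>2"
    using c by (simp add: power2_sum power_mult_distrib)
  then show "N + c * x i = ?r x + - (N / 2) * (norm_pi_sq n \<pi> x - 1)"
    unfolding * using N by (simp add: field_simps power2_eq_square)
qed

text \<open>With u = (N + x_i)/(2 N), both u and 1 - u are positive multiples of the affine
  functions in \<open>sos_mod_affine\<close>, for c = 1 and c = -1.\<close>

lemma sos_mod_Bernstein:
  assumes N: "0 < N" "\<And>i. i < n \<Longrightarrow> 1 \<le> N\<^sup>2 * \<pi> i" and i: "i < n"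
  shows "sos_mod n \<pi> (\<lambda>x. Bernstein m k ((N + x i) / (2 * N)))"
proof -
  have eq: "(\<lambda>x. Bernstein m k ((N + x i) / (2 * N))) = (\<lambda>x. real (m choose k) *
      (1 / (2 * N) * (N + 1 * x i)) ^ k * (1 / (2 * N) * (N + (- 1) * x i)) ^ (m - k))"
  proof
    fix x :: "nat \<Rightarrow> real"
    have "1 - (N + x i) / (2 * N) = 1 / (2 * N) * (N + (- 1) * x i)" using N by (simp add: field_simps)
    then show "Bernstein m k ((N + x i) / (2 * N)) = real (m choose k) *
      (1 / (2 * N) * (N + 1 * x i)) ^ k * (1 / (2 * N) * (N + (- 1) * x i)) ^ (m - k)"
      unfolding Bernstein_def by simp
  qed
  show ?thesis unfolding eq
    using N i by (intro sos_mod_mult sos_mod_power sos_mod_const sos_mod_affine) auto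
qed

section \<open>Quadratic forms with polynomial coefficients\<close>

text \<open>The vector v is kept independent of x: many matrices give the same polynomial at v = x -
  1, and the certificate exploits the freedom to choose among them.\<close>

definition qform :: "nat \<Rightarrow> ((nat \<Rightarrow> real) \<Rightarrow> (nat \<Rightarrow> real) \<Rightarrow> real) \<Rightarrow> bool" where
  "qform n G \<longleftrightarrow> (\<exists>a. (\<forall>i j. is_poly n (a i j)) \<and>
     G = (\<lambda>x v. \<Sum>i<n. \<Sum>j<n. a i j x * v i * v j))"

lemma qform_add:
  assumes "qform n G" "qform n H" shows "qform n (\<lambda>x v. G x v + H x v)"
proof -
  from assms obtain a b where *: "\<forall>i j. is_poly n (a i j)" "\<forall>i j. is_poly n (b i j)"
    "G = (\<lambda>x v. \<Sum>i<n. \<Sum>j<n. a i j x * v i * v j)" "H = (\<lambda>x v. \<Sum>i<n. \<Sum>j<n. b i j x * v i * v j)"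
    unfolding qform_def by blast
  then show ?thesis unfolding qform_def
    by (intro exI[of _ "\<lambda>i j x. a i j x + b i j x"]) (auto simp: sum.distrib distrib_right)
qed

lemma qform_mult:
  assumes "qform n G" "is_poly n g" shows "qform n (\<lambda>x v. g x * G x v)"
proof -
  from assms obtain a where *: "\<forall>i j. is_poly n (a i j)"
    "G = (\<lambda>x v. \<Sum>i<n. \<Sum>j<n. a i j x * v i * v j)"
    unfolding qform_def by blast
  then show ?thesis unfolding qform_def using assms(2)
    by (intro exI[of _ "\<lambda>i j x. g x * a i j x"]) (auto simp: sum_distrib_left mult.assoc)
qed

lemma qform_linear_square:
  assumes b: "\<And>i. i < n \<Longrightarrow> is_poly n (b i)"
  shows "qform n (\<lambda>x v. (\<Sum>i<n. b i x * v i)\<^sup>2)"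
  unfolding qform_def power2_eq_square sum_product
proof (intro exI[of _ "\<lambda>i j x. if i < n \<and> j < n then b i x * b j x else 0"] conjI allI ext sum.cong refl)
  fix i j
  show "is_poly n (\<lambda>x. if i < n \<and> j < n then b i x * b j x else 0)"
    using b by (cases "i < n \<and> j < n") auto
qed auto

lemma qform_norm: "qform n (\<lambda>x v. norm_pi_sq n \<pi> v)"
proof -
  have "(\<Sum>j<n. (if i = j then \<pi> i else 0) * v i * v j) = \<pi> i * (v i)\<^sup>2" if "i < n" for i and v :: "nat \<Rightarrow> real"
  proof -
    have "(\<Sum>j<n. (if i = j then \<pi> i else 0) * v i * v j) = (\<Sum>j<n. if i = j then \<pi> i * (v i)\<^sup>2 else 0)"
      by (intro sum.cong refl) (simp add: power2_eq_square)
    then show ?thesis using that by simp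
  qed
  then show ?thesis unfolding qform_def norm_pi_sq_def
    by (intro exI[of _ "\<lambda>i j x. if i = j then \<pi> i else 0"]) auto
qed

lemma qform_scale:
  assumes "qform n G" shows "G x (\<lambda>i. t * v i) = t\<^sup>2 * G x v"
proof -
  from assms obtain a where "G = (\<lambda>x v. \<Sum>i<n. \<Sum>j<n. a i j x * v i * v j)"
    unfolding qform_def by blast
  then show ?thesis by (simp add: sum_distrib_left power2_eq_square mult_ac)
qed

lemma qform_cong:
  assumes "qform n G" "\<And>i. i < n \<Longrightarrow> x i = x' i" "\<And>i. i < n \<Longrightarrow> v i = v' i"
  shows "G x v = G x' v'"
proof -
  from assms obtain a where a: "\<And>i j. is_poly n (a i j)" "G = (\<lambda>x v. \<Sum>i<n. \<Sum>j<n. a i j x * v i * v j)"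
    unfolding qform_def by blast
  have "a i j x = a i j x'" for i j by (rule is_poly_cong[OF a(1)]) (use assms in auto)
  then show ?thesis using assms by (auto simp: a(2))
qed

lemma qform_continuous:
  assumes "qform n G" and x: "continuous_on A x" and v: "continuous_on A v"
  shows "continuous_on A (\<lambda>t. G (x t) (v t))"
proof -
  from assms obtain a where a: "\<And>i j. is_poly n (a i j)" "G = (\<lambda>x v. \<Sum>i<n. \<Sum>j<n. a i j x * v i * v j)"
    unfolding qform_def by blast
  have "continuous_on A (\<lambda>t. a i j (x t))" for i j
    by (rule continuous_on_compose2[OF is_poly_continuous[OF a(1)] x]) auto
  then show ?thesis unfolding a(2)
    by (intro continuous_intros continuous_on_product_then_coordinatewise[OF v]) auto
qed

section \<open>Compactness and positive definite forms on the weighted sphere\<close>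

definition usphere :: "nat \<Rightarrow> (nat \<Rightarrow> real) \<Rightarrow> (nat \<Rightarrow> real) set" where
  "usphere n \<pi> = {v. norm_pi_sq n \<pi> v = 1 \<and> (\<forall>i\<ge>n. v i = 0)}"

text \<open>The condition on \<open>N\<close> has two uses: the sphere lies in [-N, N]^n, and N +
  x_i and N - x_i are sums of squares modulo the sphere.\<close>

locale weighted_sphere =
  fixes n :: nat and \<pi> :: "nat \<Rightarrow> real" and N :: real
  assumes pos: "\<And>i. i < n \<Longrightarrow> 0 < \<pi> i" and sum1: "(\<Sum>i<n. \<pi> i) = 1"
    and N0: "0 < N" and N: "\<And>i. i < n \<Longrightarrow> 1 \<le> N\<^sup>2 * \<pi> i"
begin

lemma n_pos: "0 < n"
  using sum1 by (cases n) auto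

lemma weighted_square_nonneg: "i < n \<Longrightarrow> 0 \<le> \<pi> i * r\<^sup>2"
  using pos[of i] by simp

lemma norm_nonneg: "0 \<le> norm_pi_sq n \<pi> v"
  unfolding norm_pi_sq_def by (auto intro!: sum_nonneg weighted_square_nonneg)

lemma norm_eq_0_iff: "norm_pi_sq n \<pi> v = 0 \<longleftrightarrow> (\<forall>i<n. v i = 0)"
proof -
  have "norm_pi_sq n \<pi> v = 0 \<longleftrightarrow> (\<forall>i\<in>{..<n}. \<pi> i * (v i)\<^sup>2 = 0)"
    unfolding norm_pi_sq_def by (intro sum_nonneg_eq_0_iff) (auto intro!: weighted_square_nonneg)
  then show ?thesis using pos by force
qed

lemma square_le_norm: "i < n \<Longrightarrow> (v i)\<^sup>2 \<le> N\<^sup>2 * norm_pi_sq n \<pi> v"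
proof -
  assume i: "i < n"
  have "(v i)\<^sup>2 \<le> N\<^sup>2 * \<pi> i * (v i)\<^sup>2" using mult_right_mono[OF N[OF i], of "(v i)\<^sup>2"] by simp
  also have "\<dots> = N\<^sup>2 * (\<pi> i * (v i)\<^sup>2)" by simp
  also have "\<dots> \<le> N\<^sup>2 * norm_pi_sq n \<pi> v"
    unfolding norm_pi_sq_def using i
    by (intro mult_left_mono member_le_sum) (auto intro!: weighted_square_nonneg)
  finally show ?thesis .
qed

lemma is_poly_norm: "is_poly n (norm_pi_sq n \<pi>)"
  using is_poly_norm_pi_sq[of n "\<lambda>i x. x i"] by auto

lemma sphere_subset_cube:
  assumes "norm_pi_sq n \<pi> v = 1" "i < n" shows "\<bar>v i\<bar> \<le> N"
  using square_le_norm[OF assms(2), of v] assms(1) N0 abs_le_square_iff[of "v i" N] by simp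

lemma compact_usphere: "compact (usphere n \<pi>)"
proof -
  have "usphere n \<pi> = cube n N \<inter> (cube n N \<inter> norm_pi_sq n \<pi> -` {1})"
    by (auto simp: usphere_def cube_def sphere_subset_cube)
  then show ?thesis
    by (simp only:) (intro compact_Int_closed compact_cube continuous_closed_preimage
        compact_imp_closed[OF compact_cube] is_poly_continuous[OF is_poly_norm] closed_singleton)
qed

lemma qform_lower_bound:
  assumes G: "qform n G" and le: "\<And>v. v \<in> usphere n \<pi> \<Longrightarrow> \<eta> \<le> G x v"
  shows "\<eta> * norm_pi_sq n \<pi> v \<le> G x v"
proof (cases "norm_pi_sq n \<pi> v = 0")
  case True
  have "G x v = G x (\<lambda>i. 0 * v i)" using True by (intro qform_cong[OF G]) (auto simp: norm_eq_0_iff)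
  also have "\<dots> = 0\<^sup>2 * G x v" by (rule qform_scale[OF G])
  finally show ?thesis using True by simp
next
  case False
  define r where "r = sqrt (norm_pi_sq n \<pi> v)"
  have r: "r > 0" "r\<^sup>2 = norm_pi_sq n \<pi> v" using False norm_nonneg[of v] by (auto simp: r_def)
  define u where "u = (\<lambda>i. if i < n then v i / r else 0)"
  have "norm_pi_sq n \<pi> u = norm_pi_sq n \<pi> (\<lambda>i. (1 / r) * v i)"
    unfolding norm_pi_sq_def u_def by (intro sum.cong) auto
  also have "\<dots> = (1 / r)\<^sup>2 * norm_pi_sq n \<pi> v" by (rule qform_scale[OF qform_norm])
  also have "\<dots> = 1" using r(1) by (simp add: power_divide flip: r(2))
  finally have u: "u \<in> usphere n \<pi>" by (simp add: usphere_def u_def)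
  have "G x v = G x (\<lambda>i. r * u i)" using r by (intro qform_cong[OF G]) (auto simp: u_def)
  also have "\<dots> = r\<^sup>2 * G x u" by (rule qform_scale[OF G])
  finally show ?thesis using mult_left_mono[OF le[OF u], of "r\<^sup>2"] norm_nonneg[of v] by (simp add: r(2) mult.commute)
qed

text \<open>For a large degree every Bernstein coefficient matrix is close to the matrix of
  \<open>G\<close> at a node of the cube, hence positive definite and a sum of squares of linear
  forms in v. Substituting polynomials for v leaves Bernstein products times sums of
  squares.\<close>

lemma qform_positive_sos_mod:
  assumes G: "qform n G" and pd: "\<And>x v. x \<in> cube n N \<Longrightarrow> v \<in> usphere n \<pi> \<Longrightarrow> 0 < G x v"
    and y: "\<And>i. i < n \<Longrightarrow> is_poly n (y i)"
  shows "sos_mod n \<pi> (\<lambda>x. G x (\<lambda>i. y i x))"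
proof -
  obtain a where a: "\<And>i j. is_poly n (a i j)" "G = (\<lambda>x v. \<Sum>i<n. \<Sum>j<n. a i j x * v i * v j)"
    using G unfolding qform_def by blast
  obtain C \<eta> where \<eta>: "0 < \<eta>" "\<And>z. z \<in> cube n N \<times> usphere n \<pi> \<Longrightarrow> \<eta> \<le> G (fst z) (snd z) + C * 0"
    by (rule compact_penalty[of "cube n N \<times> usphere n \<pi>" "\<lambda>z. G (fst z) (snd z)" "\<lambda>z. 0"])
      (use pd in \<open>auto intro!: compact_Times compact_cube compact_usphere qform_continuous[OF G]
        continuous_on_fst continuous_on_snd\<close>)
  have lb: "\<eta> * norm_pi_sq n \<pi> v \<le> G x v" if "\<And>i. i < n \<Longrightarrow> \<bar>x i\<bar> \<le> N" for x v
  proof -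
    define x' where "x' = (\<lambda>i. if i < n then x i else 0)"
    have "G x v = G x' v" by (rule qform_cong[OF G]) (auto simp: x'_def)
    moreover have "x' \<in> cube n N" using that by (auto simp: cube_def x'_def)
    then have "\<eta> * norm_pi_sq n \<pi> v \<le> G x' v"
      using \<eta>(2)[of "(x', _)"] by (intro qform_lower_bound[OF G]) auto
    ultimately show ?thesis by simp
  qed
  \<comment> \<open>Since |v_i v_j| \<le> N^2 ||v||^2, changing all n^2 entries by at most
    \<open>e\<close> changes the form by at most \<eta>/2 ||v||^2.\<close>
  define e where "e = \<eta> / (2 * (real n)\<^sup>2 * N\<^sup>2)"
  have e: "0 < e" "(real n)\<^sup>2 * e * N\<^sup>2 = \<eta> / 2" using \<eta> N0 n_pos by (auto simp: e_def)
  define B where "B = (\<lambda>m. PiE {..<n} (\<lambda>_. {..m::nat}))"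
  define node where "node = (\<lambda>m (K :: nat \<Rightarrow> nat) i. N * (2 * (real (K i) / real (m::nat)) - 1))"
  define R where "R = (\<lambda>m p c. (\<forall>x. a (fst p) (snd p) x
      = (\<Sum>K\<in>B m. c K * (\<Prod>i<n. Bernstein m (K i) ((N + x i) / (2 * N))))) \<and>
    (\<forall>K\<in>B m. \<bar>c K - a (fst p) (snd p) (node m K)\<bar> \<le> e))"
  \<comment> \<open>One degree must serve all entries, so that their coefficients at each
    \<open>K\<close> form a matrix.\<close>
  have "\<forall>\<^sub>F m in sequentially. \<forall>p\<in>{..<n} \<times> {..<n}. \<exists>c. R m p c"
    unfolding R_def B_def node_def
    by (intro eventually_ball_finite ballI Bernstein_poly a N0 e) auto
  then obtain m where "\<forall>p\<in>{..<n} \<times> {..<n}. \<exists>c. R m p c"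
    by (auto simp: eventually_sequentially)
  from bchoice[OF this] obtain c' where c': "\<forall>p\<in>{..<n} \<times> {..<n}. R m p (c' p)" by blast
  define c where "c = (\<lambda>i j. c' (i, j))"
  have c: "R m (i, j) (c i j)" if "i < n" "j < n" for i j using c' that by (auto simp: c_def)
  have c1: "a i j x = (\<Sum>K\<in>B m. c i j K * (\<Prod>i<n. Bernstein m (K i) ((N + x i) / (2 * N))))"
    if "i < n" "j < n" for i j x using c[OF that] by (auto simp: R_def)
  have c2: "\<bar>c i j K - a i j (node m K)\<bar> \<le> e" if "i < n" "j < n" "K \<in> B m" for i j K
    using c[OF that(1,2)] that(3) by (auto simp: R_def)
  have "\<exists>ls. \<forall>v. (\<Sum>i<n. \<Sum>j<n. c i j K * v i * v j) = (\<Sum>l\<leftarrow>ls. (\<Sum>i<n. l i * v i)\<^sup>2)"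
    if K: "K \<in> B m" for K
  proof (rule quadratic_form_sum_squares)
    fix v :: "nat \<Rightarrow> real" assume "\<exists>i<n. v i \<noteq> 0"
    then have v: "0 < norm_pi_sq n \<pi> v" using norm_eq_0_iff[of v] norm_nonneg[of v] by force
    have "\<bar>node m K i\<bar> \<le> N" if "i < n" for i
    proof -
      have "K i \<le> m" using K that by (auto simp: B_def PiE_iff)
      then have "real (K i) / real m \<le> 1" by (cases "m = 0") auto
      then have "\<bar>2 * (real (K i) / real m) - 1\<bar> \<le> 1" by (auto simp: abs_le_iff)
      then show ?thesis using N0 by (simp add: node_def abs_mult)
    qed
    then have 1: "\<eta> * norm_pi_sq n \<pi> v \<le> G (node m K) v" by (rule lb)
    have "\<bar>(\<Sum>i<n. \<Sum>j<n. (c i j K - a i j (node m K)) * v i * v j)\<bar>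
      \<le> (\<Sum>i<n. \<Sum>j<n. e * (N\<^sup>2 * norm_pi_sq n \<pi> v))"
    proof (intro order.trans[OF sum_abs] sum_mono order.trans[OF sum_abs])
      fix i j assume "i \<in> {..<n}" "j \<in> {..<n}"
      then have ij: "i < n" "j < n" by auto
      have "\<bar>v i * v j\<bar> \<le> ((v i)\<^sup>2 + (v j)\<^sup>2) / 2"
        using sum_squares_bound[of "\<bar>v i\<bar>" "\<bar>v j\<bar>"] by (simp add: abs_mult)
      also have "\<dots> \<le> N\<^sup>2 * norm_pi_sq n \<pi> v"
        using square_le_norm[OF ij(1), of v] square_le_norm[OF ij(2), of v] by simp
      finally have *: "\<bar>v i * v j\<bar> \<le> N\<^sup>2 * norm_pi_sq n \<pi> v" .
      show "\<bar>(c i j K - a i j (node m K)) * v i * v j\<bar> \<le> e * (N\<^sup>2 * norm_pi_sq n \<pi> v)"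
        using mult_mono[OF c2[OF ij K] *] e by (simp add: abs_mult mult.assoc)
    qed
    also have "\<dots> = (real n)\<^sup>2 * e * N\<^sup>2 * norm_pi_sq n \<pi> v" by (simp add: power2_eq_square)
    also have "\<dots> = \<eta> / 2 * norm_pi_sq n \<pi> v" by (simp add: e)
    finally have 2: "\<bar>(\<Sum>i<n. \<Sum>j<n. (c i j K - a i j (node m K)) * v i * v j)\<bar> \<le> \<eta> / 2 * norm_pi_sq n \<pi> v" .
    have "(\<Sum>i<n. \<Sum>j<n. c i j K * v i * v j) = G (node m K) v
        + (\<Sum>i<n. \<Sum>j<n. (c i j K - a i j (node m K)) * v i * v j)"
      unfolding a(2) by (simp add: left_diff_distrib sum_subtractf)
    moreover have "0 < \<eta> * norm_pi_sq n \<pi> v" using \<eta>(1) v by simp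
    ultimately show "0 < (\<Sum>i<n. \<Sum>j<n. c i j K * v i * v j)" using 1 2 by linarith
  qed
  then have "\<forall>K\<in>B m. \<exists>ls. \<forall>v. (\<Sum>i<n. \<Sum>j<n. c i j K * v i * v j) = (\<Sum>l\<leftarrow>ls. (\<Sum>i<n. l i * v i)\<^sup>2)"
    by blast
  from bchoice[OF this] obtain ls where ls: "\<forall>K\<in>B m. \<forall>v.
      (\<Sum>i<n. \<Sum>j<n. c i j K * v i * v j) = (\<Sum>l\<leftarrow>ls K. (\<Sum>i<n. l i * v i)\<^sup>2)" by blast
  have G_eq: "G x v = (\<Sum>K\<in>B m. (\<Prod>i<n. Bernstein m (K i) ((N + x i) / (2 * N))) *
      (\<Sum>l\<leftarrow>ls K. (\<Sum>i<n. l i * v i)\<^sup>2))" for x v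
  proof -
    have "G x v = (\<Sum>i<n. \<Sum>j<n. \<Sum>K\<in>B m. (\<Prod>i<n. Bernstein m (K i) ((N + x i) / (2 * N))) * (c i j K * v i * v j))"
      unfolding a(2) by (intro sum.cong refl) (simp add: c1 sum_distrib_left sum_distrib_right mult_ac)
    also have "\<dots> = (\<Sum>i<n. \<Sum>K\<in>B m. \<Sum>j<n. (\<Prod>i<n. Bernstein m (K i) ((N + x i) / (2 * N))) * (c i j K * v i * v j))"
      by (intro sum.cong refl sum.swap)
    also have "\<dots> = (\<Sum>K\<in>B m. \<Sum>i<n. \<Sum>j<n. (\<Prod>i<n. Bernstein m (K i) ((N + x i) / (2 * N))) * (c i j K * v i * v j))"
      by (rule sum.swap)
    also have "\<dots> = (\<Sum>K\<in>B m. (\<Prod>i<n. Bernstein m (K i) ((N + x i) / (2 * N))) * (\<Sum>i<n. \<Sum>j<n. c i j K * v i * v j))"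
      by (simp add: sum_distrib_left)
    finally show ?thesis using ls by simp
  qed
  have "sos_mod n \<pi> (\<lambda>x. (\<Prod>i<n. Bernstein m (K i) ((N + x i) / (2 * N))) *
      (\<Sum>l\<leftarrow>ls K. (\<Sum>i<n. l i * y i x)\<^sup>2))" for K
  proof (rule sos_mod_mult)
    show "sos_mod n \<pi> (\<lambda>x. \<Prod>i<n. Bernstein m (K i) ((N + x i) / (2 * N)))"
      using N0 N by (intro sos_mod_prod sos_mod_Bernstein) auto
    show "sos_mod n \<pi> (\<lambda>x. \<Sum>l\<leftarrow>ls K. (\<Sum>i<n. l i * y i x)\<^sup>2)"
      using y by (intro sos_mod_sos poly_sos_sum_list poly_sos_square) auto
  qed
  then show ?thesis unfolding G_eq by (intro sos_mod_sum)
qed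

end

text \<open>Replaces the nonsmooth penalty max 0 (-t), up to \<eta>, by -t times a square, which the
  multipliers x_i \<sigma>_i can absorb. For t > 0 the power decays fast enough to keep the product
  small; for t < 0 it grows with k.\<close>

lemma orthant_penalty:
  fixes C \<eta> N :: real
  assumes "0 \<le> C" "0 < \<eta>" "0 < N"
  shows "\<exists>k. \<forall>t. \<bar>t\<bar> \<le> N \<longrightarrow> C * max 0 (- t) - \<eta> \<le> - t * (1 - t / N) ^ (2 * k)"
proof -
  \<comment> \<open>The summand C^2 serves negative t, the summand 1 nonnegative t.\<close>
  obtain k :: nat where k: "(C\<^sup>2 + 1) * N / \<eta> < real k" using reals_Archimedean2 by blast
  have "0 \<le> (C\<^sup>2 + 1) * N / \<eta>" using assms by auto
  then have k0: "0 < real k" using k by linarith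
  have k1: "(C\<^sup>2 + 1) * N < real k * \<eta>" using k assms by (simp add: field_simps)
  show ?thesis
  proof (intro exI[of _ k] allI impI)
    fix t :: real assume t: "\<bar>t\<bar> \<le> N"
    show "C * max 0 (- t) - \<eta> \<le> - t * (1 - t / N) ^ (2 * k)"
    proof (cases "0 \<le> t")
      case True
      define u where "u = t / N"
      have u: "0 \<le> u" "u \<le> 1" "t = N * u" using True t assms by (auto simp: u_def)
      \<comment> \<open>Bernoulli's inequality multiplied by (1 - u)^(2k): as (1 - u^2)^(2k) \<le>
        1, the product u (1 - u)^(2k) is of order 1/k.\<close>
      have "(1 - u) ^ (2 * k) * (1 + real (2 * k) * u) \<le> (1 - u) ^ (2 * k) * (1 + u) ^ (2 * k)"
        using u by (intro mult_left_mono Bernoulli_inequality) auto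
      also have "\<dots> = (1 - u\<^sup>2) ^ (2 * k)"
        by (simp add: power_mult_distrib[symmetric] algebra_simps power2_eq_square)
      also have "\<dots> \<le> 1" using u by (intro power_le_one) (auto simp: power_le_one)
      finally have "(1 - u) ^ (2 * k) * (real (2 * k) * u) + (1 - u) ^ (2 * k) \<le> 1" by (simp add: algebra_simps)
      moreover have "0 \<le> (1 - u) ^ (2 * k)" using u by auto
      ultimately have "(1 - u) ^ (2 * k) * (real (2 * k) * u) \<le> 1" by linarith
      then have "real k * (u * (1 - u) ^ (2 * k)) \<le> 1" using u by (simp add: algebra_simps)
      then have "N * (real k * (u * (1 - u) ^ (2 * k))) \<le> N" using assms by simp
      also have "N \<le> (C\<^sup>2 + 1) * N" using assms by simp
      also have "\<dots> < real k * \<eta>" by (rule k1)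
      finally have "real k * (t * (1 - u) ^ (2 * k)) < real k * \<eta>" by (simp add: u(3) algebra_simps)
      then have "t * (1 - u) ^ (2 * k) < \<eta>" using k0 by simp
      then show ?thesis using True by (simp add: u_def)
    next
      case False
      define r where "r = - t"
      have r: "r > 0" using False by (simp add: r_def)
      have "1 + real (2 * k) * (r / N) \<le> (1 + r / N) ^ (2 * k)"
        using r assms by (intro Bernoulli_inequality) (auto simp: field_simps)
      then have "r * (1 + real (2 * k) * (r / N)) \<le> r * (1 + r / N) ^ (2 * k)" using r by simp
      moreover have "C * r - \<eta> \<le> r * (1 + real (2 * k) * (r / N))"
      proof -
        define q where "q = real k / N"
        have q: "q > 0" "C\<^sup>2 \<le> q * \<eta>" using k0 k1 assms by (auto simp: q_def field_simps)
        \<comment> \<open>Young's inequality with weight q: C r \<le> C^2/(4 q) + q r^2, where C^2/q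
          \<le> \<eta>.\<close>
        have "0 \<le> (C - 2 * (q * r))\<^sup>2" by simp
        also have "\<dots> = C\<^sup>2 - q * (4 * (C * r)) + q * (4 * (q * r\<^sup>2))"
          by (simp add: power2_eq_square algebra_simps)
        finally have "q * (4 * (C * r)) \<le> q * (\<eta> + 4 * (q * r\<^sup>2))"
          using q(2) by (simp add: distrib_left)
        then have "4 * (C * r) \<le> \<eta> + 4 * (q * r\<^sup>2)" using q(1) by simp
        moreover have "r * (1 + real (2 * k) * (r / N)) = r + 2 * (q * r\<^sup>2)"
          by (simp add: q_def power2_eq_square algebra_simps)
        moreover have "0 \<le> q * r\<^sup>2" using q(1) by simp
        ultimately show ?thesis using r assms(2) by linarith
      qed
      ultimately have "C * r - \<eta> \<le> r * (1 + r / N) ^ (2 * k)" by linarith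
      then show ?thesis using r by (simp add: r_def)
    qed
  qed
qed

section \<open>Certificates for polynomials with a nondegenerate interior zero\<close>

lemma nonneg_of_right_limit:
  fixes F :: "real \<Rightarrow> real"
  assumes "continuous_on UNIV F" "\<forall>\<^sub>F t in at_right 0. 0 \<le> F t"
  shows "0 \<le> F 0"
proof -
  have "isCont F 0" using assms(1) by (simp add: continuous_on_eq_continuous_at)
  then have "(F \<longlongrightarrow> F 0) (at_right 0)"
    unfolding isCont_def by (rule filterlim_mono) (auto intro: at_le)
  from tendsto_lowerbound[OF this assms(2)] show ?thesis by simp
qed

context weighted_sphere
begin

text \<open>Stereographic parametrisation of the great circle through \<open>(1, \<dots>, 1)\<close> in the tangent
  direction \<open>v\<close>: it is rational, so \<open>x - 1\<close> is divisible by the parameter.\<close>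
lemma tangent_curve:
  assumes tan: "(\<Sum>i<n. \<pi> i * v i) = 0"
  obtains w :: "real \<Rightarrow> nat \<Rightarrow> real" where "w 0 = (\<lambda>i. 2 * v i)" "continuous_on UNIV w"
    "\<forall>\<^sub>F t in at_right 0. (\<lambda>i. 1 + t * w t i) \<in> S_pi n \<pi>"
proof -
  define r where "r = norm_pi_sq n \<pi> v"
  have r: "r \<ge> 0" by (simp add: r_def norm_nonneg)
  define c where "c = (\<lambda>t. 1 + r * t\<^sup>2)"
  have c: "c t > 0" for t unfolding c_def using r by (intro add_pos_nonneg) auto
  \<comment> \<open>Chosen so that 1 + t w_i = (1 - r t^2 + 2 t v_i)/(1 + r t^2), a point of the
    sphere since (1 - r t^2)^2 + 4 r t^2 = (1 + r t^2)^2.\<close>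
  define w where "w = (\<lambda>t i. (2 * v i - 2 * r * t) / c t)"
  have cont: "continuous_on UNIV (\<lambda>t. w t i)" for i
    unfolding w_def using c by (intro continuous_intros) (auto simp: c_def less_imp_neq[symmetric] intro!: continuous_intros)
  have "\<forall>\<^sub>F t in at_right 0. \<forall>i\<in>{..<n}. 0 < 1 + t * w t i"
  proof (intro eventually_ball_finite ballI)
    fix i
    have "continuous_on UNIV (\<lambda>t. 1 + t * w t i)" by (intro continuous_intros cont)
    then have "isCont (\<lambda>t. 1 + t * w t i) 0" by (simp add: continuous_on_eq_continuous_at)
    then have "((\<lambda>t. 1 + t * w t i) \<longlongrightarrow> 1) (at 0)" by (simp add: isCont_def)
    then have "((\<lambda>t. 1 + t * w t i) \<longlongrightarrow> 1) (at_right 0)"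
      by (rule filterlim_mono) (auto intro: at_le)
    from order_tendstoD(1)[OF this, of 0] show "\<forall>\<^sub>F t in at_right 0. 0 < 1 + t * w t i" by simp
  qed auto
  moreover have "norm_pi_sq n \<pi> (\<lambda>i. 1 + t * w t i) = 1" for t
  proof -
    have eq: "1 + t * w t i = ((1 - r * t\<^sup>2) + 2 * t * v i) / c t" for i
      unfolding w_def using c[of t] by (simp add: field_simps) (simp add: c_def power2_eq_square algebra_simps)
    have "norm_pi_sq n \<pi> (\<lambda>i. 1 + t * w t i) = (\<Sum>i<n. ((1 - r * t\<^sup>2)\<^sup>2 * \<pi> i
        + 4 * t * (1 - r * t\<^sup>2) * (\<pi> i * v i) + 4 * t\<^sup>2 * (\<pi> i * (v i)\<^sup>2)) / (c t)\<^sup>2)"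
      unfolding norm_pi_sq_def eq
      by (intro sum.cong refl) (simp add: power_divide power2_eq_square algebra_simps)
    also have "\<dots> = ((1 - r * t\<^sup>2)\<^sup>2 * (\<Sum>i<n. \<pi> i) + 4 * t * (1 - r * t\<^sup>2) * (\<Sum>i<n. \<pi> i * v i)
        + 4 * t\<^sup>2 * norm_pi_sq n \<pi> v) / (c t)\<^sup>2"
      unfolding norm_pi_sq_def by (simp add: sum_divide_distrib[symmetric] sum.distrib sum_distrib_left)
    also have "\<dots> = ((1 - r * t\<^sup>2)\<^sup>2 + 4 * t\<^sup>2 * r) / (c t)\<^sup>2"
      using tan sum1 by (simp add: r_def)
    also have "(1 - r * t\<^sup>2)\<^sup>2 + 4 * t\<^sup>2 * r = (c t)\<^sup>2" by (simp add: c_def power2_eq_square algebra_simps)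
    finally show ?thesis using c[of t] by simp
  qed
  ultimately have "\<forall>\<^sub>F t in at_right 0. (\<lambda>i. 1 + t * w t i) \<in> S_pi n \<pi>"
    by (auto simp: S_pi_def elim!: eventually_mono intro: less_imp_le)
  moreover have "w 0 = (\<lambda>i. 2 * v i)" by (simp add: w_def c_def)
  moreover have "continuous_on UNIV w" by (intro continuous_on_coordinatewise_then_product cont)
  ultimately show ?thesis using that by blast
qed

text \<open>\<open>Q\<close> forces quadratic growth of f at (1,...,1) in tangent directions. At v =
  x - 1 the forms \<open>G1\<close> to \<open>G4\<close> return f up to multiples of
  \<open>s\<close> and, for \<open>G4\<close>, multiplier terms, while positivity spreads: tangent
  directions at (1,...,1), all directions there, the nonnegative part of the sphere, the
  cube.\<close>

theorem local_global_sos: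
  assumes f: "is_poly n f" and f1: "f (\<lambda>i. 1) = 0"
    and Q: "is_poly n Q" "\<And>t v. Q (\<lambda>i. t * v i) = t\<^sup>2 * Q v"
    and Qpos: "\<And>v. (\<Sum>i<n. \<pi> i * v i) = 0 \<Longrightarrow> \<exists>i<n. v i \<noteq> 0 \<Longrightarrow> 0 < Q v"
    and fQ: "\<And>x. x \<in> S_pi n \<pi> \<Longrightarrow> Q (\<lambda>i. x i - 1) \<le> f x"
    and fpos: "\<And>x. x \<in> S_pi n \<pi> \<Longrightarrow> \<exists>i<n. x i \<noteq> 1 \<Longrightarrow> 0 < f x"
  shows "\<exists>\<sigma>0 \<sigma> \<phi>. poly_sos n \<sigma>0 \<and> (\<forall>i<n. poly_sos n (\<sigma> i)) \<and> is_poly n \<phi> \<and>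
    f = (\<lambda>x. \<sigma>0 x + (\<Sum>i<n. x i * \<sigma> i x) + \<phi> x * (norm_pi_sq n \<pi> x - 1))"
proof -
  define s where "s = (\<lambda>x. norm_pi_sq n \<pi> x - 1)"
  define y where "y = (\<lambda>(x :: nat \<Rightarrow> real) i. x i - 1)"
  define q where "q = (\<lambda>x. norm_pi_sq n \<pi> (y x))"
  define L where "L = (\<lambda>v :: nat \<Rightarrow> real. \<Sum>i<n. \<pi> i * v i)"
  have s_fold: "norm_pi_sq n \<pi> x - 1 = s x" and q_fold: "norm_pi_sq n \<pi> (y x) = q x" for x
    by (simp_all add: s_def q_def)
  have s_poly: "is_poly n s" unfolding s_def using is_poly_norm by auto
  have q_poly: "is_poly n q" unfolding q_def y_def by (intro is_poly_norm_pi_sq) auto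
  have L_qform: "qform n (\<lambda>x v. (L v)\<^sup>2)" unfolding L_def by (rule qform_linear_square) auto
  have s_eq: "s x = 2 * L (y x) + q x" for x
  proof -
    have "norm_pi_sq n \<pi> x = (\<Sum>i<n. \<pi> i + 2 * (\<pi> i * y x i) + \<pi> i * (y x i)\<^sup>2)"
      unfolding norm_pi_sq_def by (intro sum.cong refl) (simp add: y_def power2_eq_square algebra_simps)
    also have "\<dots> = 1 + 2 * L (y x) + q x"
      by (simp add: sum.distrib sum1 L_def q_def norm_pi_sq_def sum_distrib_left)
    finally show ?thesis by (simp add: s_def)
  qed
  have f_nonneg: "0 \<le> f x" if x: "x \<in> S_pi n \<pi>" for x
  proof (cases "\<exists>i<n. x i \<noteq> 1")
    case False
    then have "f x = f (\<lambda>i. 1)" by (intro is_poly_cong[OF f]) auto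
    then show ?thesis using f1 by simp
  qed (use fpos[OF x] in auto)

  obtain D a where a: "\<forall>i j. is_poly n (a i j)" and
    fD: "f = (\<lambda>x. f (\<lambda>i. 1) + (\<Sum>i<n. D i * (x i - 1)) + (\<Sum>i<n. \<Sum>j<n. a i j x * (x i - 1) * (x j - 1)))"
    using is_poly_taylor2[OF f] by blast
  define G0 where "G0 = (\<lambda>x v. \<Sum>i<n. \<Sum>j<n. a i j x * v i * v j)"
  have G0: "qform n G0" unfolding qform_def G0_def using a by blast
  have f_G0: "f x = (\<Sum>i<n. D i * y x i) + G0 x (y x)" for x
    using fun_cong[OF fD, of x] f1 by (simp add: G0_def y_def)

  text \<open>The tangential gradient of \<open>f\<close> at its minimum \<open>(1, \<dots>, 1)\<close> vanishes.\<close>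
  have D_nonneg: "0 \<le> (\<Sum>i<n. D i * v i)" if tan: "L v = 0" for v
  proof -
    obtain w where w: "w 0 = (\<lambda>i. 2 * v i)" "continuous_on UNIV w"
      "\<forall>\<^sub>F t in at_right 0. (\<lambda>i. 1 + t * w t i) \<in> S_pi n \<pi>"
      using tangent_curve[of v] tan unfolding L_def by blast
    define F where "F = (\<lambda>t. (\<Sum>i<n. D i * w t i) + t * G0 (\<lambda>i. 1 + t * w t i) (w t))"
    have wi: "continuous_on UNIV (\<lambda>t. w t i)" for i
      by (rule continuous_on_product_then_coordinatewise[OF w(2)])
    have "continuous_on UNIV (\<lambda>t. G0 (\<lambda>i. 1 + t * w t i) (w t))"
      by (intro qform_continuous[OF G0] w(2) continuous_on_coordinatewise_then_product continuous_intros wi)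
    then have "continuous_on UNIV F" unfolding F_def
      by (intro continuous_intros wi) auto
    moreover have "\<forall>\<^sub>F t in at_right 0. 0 \<le> F t"
    proof (rule eventually_mono[OF eventually_conj[OF w(3) eventually_at_right_less]])
      fix t :: real assume t: "(\<lambda>i. 1 + t * w t i) \<in> S_pi n \<pi> \<and> 0 < t"
      have "0 \<le> f (\<lambda>i. 1 + t * w t i)" using f_nonneg t by blast
      also have "\<dots> = (\<Sum>i<n. D i * (t * w t i)) + G0 (\<lambda>i. 1 + t * w t i) (\<lambda>i. t * w t i)"
        unfolding f_G0 by (simp add: y_def)
      also have "G0 (\<lambda>i. 1 + t * w t i) (\<lambda>i. t * w t i) = t\<^sup>2 * G0 (\<lambda>i. 1 + t * w t i) (w t)"
        by (rule qform_scale[OF G0])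
      also have "(\<Sum>i<n. D i * (t * w t i)) + t\<^sup>2 * G0 (\<lambda>i. 1 + t * w t i) (w t) = t * F t"
        unfolding F_def by (simp add: sum_distrib_left power2_eq_square algebra_simps)
      finally show "0 \<le> F t" using t by (simp add: zero_le_mult_iff)
    qed
    ultimately have "0 \<le> F 0" by (rule nonneg_of_right_limit)
    also have "F 0 = 2 * (\<Sum>i<n. D i * v i)" by (simp add: F_def w(1) sum_distrib_left mult_ac)
    finally show ?thesis by simp
  qed
  have D_zero: "(\<Sum>i<n. D i * v i) = 0" if "L v = 0" for v
    using D_nonneg[of v] D_nonneg[of "\<lambda>i. - v i"] that by (simp add: L_def sum_negf)
  define \<mu> where "\<mu> = (\<Sum>i<n. D i)"
  have D_eq: "D i = \<mu> * \<pi> i" if i: "i < n" for i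
  proof -
    \<comment> \<open>The i-th unit vector minus \<pi>_i (1,...,1) is tangent because \<pi> sums to
      1; testing on it shows that the gradient is a multiple of \<pi>.\<close>
    have "L (\<lambda>j. (if j = i then 1 else 0) - \<pi> i) = (\<Sum>j<n. (if j = i then \<pi> j else 0) - \<pi> i * \<pi> j)"
      unfolding L_def by (intro sum.cong refl) (simp add: algebra_simps)
    also have "\<dots> = 0" using i sum1 by (simp add: sum_subtractf sum_distrib_left[symmetric])
    finally have "(\<Sum>j<n. D j * ((if j = i then 1 else 0) - \<pi> i)) = 0" by (rule D_zero)
    moreover have "(\<Sum>j<n. D j * ((if j = i then 1 else 0) - \<pi> i)) = (\<Sum>j<n. (if j = i then D j else 0) - D j * \<pi> i)"
      by (intro sum.cong refl) (simp add: algebra_simps)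
    moreover have "\<dots> = D i - \<mu> * \<pi> i" using i by (simp add: sum_subtractf sum_distrib_right[symmetric] \<mu>_def)
    ultimately show ?thesis by simp
  qed
  have DL: "(\<Sum>i<n. D i * v i) = \<mu> * L v" for v
    unfolding L_def sum_distrib_left by (intro sum.cong refl) (simp add: D_eq)

  \<comment> \<open>By \<open>s_eq\<close> the linear term \<mu> L(y) equals \<mu> (s - q)/2, and
    -\<mu> q/2 is quadratic in y, so it joins the form.\<close>
  define G1 where "G1 = (\<lambda>x v. G0 x v + (- \<mu> / 2) * norm_pi_sq n \<pi> v)"
  have G1: "qform n G1" unfolding G1_def by (intro qform_add qform_mult G0 qform_norm) auto
  have f_G1: "f x = G1 x (y x) + \<mu> / 2 * s x" for x
    unfolding f_G0 DL s_eq G1_def by (simp add: q_def algebra_simps)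
  have G1_tan: "0 < G1 (\<lambda>i. 1) v" if tan: "L v = 0" and v: "\<exists>i<n. v i \<noteq> 0" for v
  proof -
    obtain w where w: "w 0 = (\<lambda>i. 2 * v i)" "continuous_on UNIV w"
      "\<forall>\<^sub>F t in at_right 0. (\<lambda>i. 1 + t * w t i) \<in> S_pi n \<pi>"
      using tangent_curve[of v] tan unfolding L_def by blast
    \<comment> \<open>Along the curve f equals t^2 G1 and dominates t^2 Q; dividing by t^2 and
      letting t tend to 0 compares the two forms at (1,...,1).\<close>
    define F where "F = (\<lambda>t. G1 (\<lambda>i. 1 + t * w t i) (w t) - Q (w t))"
    have wi: "continuous_on UNIV (\<lambda>t. w t i)" for i
      by (rule continuous_on_product_then_coordinatewise[OF w(2)])
    have "continuous_on UNIV (\<lambda>t. G1 (\<lambda>i. 1 + t * w t i) (w t))"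
      by (intro qform_continuous[OF G1] w(2) continuous_on_coordinatewise_then_product continuous_intros wi)
    moreover have "continuous_on UNIV (\<lambda>t. Q (w t))"
      by (rule continuous_on_compose2[OF is_poly_continuous[OF Q(1)] w(2)]) auto
    ultimately have "continuous_on UNIV F" unfolding F_def by (intro continuous_intros)
    moreover have "\<forall>\<^sub>F t in at_right 0. 0 \<le> F t"
    proof (rule eventually_mono[OF eventually_conj[OF w(3) eventually_at_right_less]])
      fix t :: real assume t: "(\<lambda>i. 1 + t * w t i) \<in> S_pi n \<pi> \<and> 0 < t"
      have y_t: "y (\<lambda>i. 1 + t * w t i) = (\<lambda>i. t * w t i)" by (auto simp: y_def)
      have "Q (y (\<lambda>i. 1 + t * w t i)) \<le> f (\<lambda>i. 1 + t * w t i)" unfolding y_def using fQ t by blast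
      also have "\<dots> = G1 (\<lambda>i. 1 + t * w t i) (y (\<lambda>i. 1 + t * w t i))"
        unfolding f_G1 using t by (simp add: s_def S_pi_def)
      finally have "t\<^sup>2 * Q (w t) \<le> t\<^sup>2 * G1 (\<lambda>i. 1 + t * w t i) (w t)"
        unfolding y_t Q(2)[of t "w t"] qform_scale[OF G1, of _ t "w t"] .
      then show "0 \<le> F t" using t by (simp add: F_def)
    qed
    ultimately have "0 \<le> F 0" by (rule nonneg_of_right_limit)
    then have "Q (\<lambda>i. 2 * v i) \<le> G1 (\<lambda>i. 1) (\<lambda>i. 2 * v i)" by (simp add: F_def w(1))
    then have "Q v \<le> G1 (\<lambda>i. 1) v" unfolding Q(2)[of 2 v] qform_scale[OF G1, of _ 2 v] by simp
    then show ?thesis using Qpos[of v] tan v by (auto simp: L_def)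
  qed

  have usphere_ne: "\<exists>i<n. v i \<noteq> 0" if "v \<in> usphere n \<pi>" for v
    using that norm_eq_0_iff[of v] by (auto simp: usphere_def)
  have L_cont: "continuous_on A L" for A unfolding L_def
    by (intro continuous_intros continuous_on_product_then_coordinatewise[OF continuous_on_id])
  \<comment> \<open>At (1,...,1), \<open>G1\<close> can fail to be positive only off the tangent
    space, where (L v)^2 > 0.\<close>
  obtain C1 \<eta>1 where C1: "0 < \<eta>1" "\<And>v. v \<in> usphere n \<pi> \<Longrightarrow> \<eta>1 \<le> G1 (\<lambda>i. 1) v + C1 * (L v)\<^sup>2"
    by (rule compact_penalty[of "usphere n \<pi>" "\<lambda>v. G1 (\<lambda>i. 1) v" "\<lambda>v. (L v)\<^sup>2"])
      (use G1_tan usphere_ne in \<open>auto intro!: compact_usphere qform_continuous[OF G1] continuous_on_const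
        continuous_on_id continuous_on_power L_cont\<close>)

  text \<open>On the sphere \<open>L y = - q / 2\<close>, so the correction below vanishes at \<open>v = y\<close>.\<close>
  define G2 where "G2 = (\<lambda>x v. G1 x v + (C1 * (L v)\<^sup>2 + (- C1 / 4 * q x) * norm_pi_sq n \<pi> v))"
  have G2: "qform n G2" unfolding G2_def
    by (intro qform_add qform_mult[OF qform_norm] qform_mult[OF L_qform] G1) (use q_poly in auto)
  \<comment> \<open>At v = y the correction is \<open>C1\<close> times L(y)^2 - q^2/4 = s (s - 2
    q)/4, which fixes the new coefficient of \<open>s\<close>.\<close>
  define \<phi>2 where "\<phi>2 = (\<lambda>x. \<mu> / 2 - C1 / 4 * (s x - 2 * q x))"
  have \<phi>2: "is_poly n \<phi>2" unfolding \<phi>2_def using s_poly q_poly by auto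
  have f_G2: "f x = G2 x (y x) + \<phi>2 x * s x" for x
  proof -
    have L_y: "L (y x) = (s x - q x) / 2" using s_eq[of x] by simp
    show ?thesis unfolding f_G1 G2_def \<phi>2_def L_y q_fold
      by (simp add: power2_eq_square field_simps)
  qed
  have q1: "q (\<lambda>i. 1) = 0" by (simp add: q_def y_def norm_pi_sq_def)

  \<comment> \<open>\<open>I\<close> is the weighted inner product of y and v, and \<open>H\<close>
    the defect in Cauchy-Schwarz: for unit v, the squared norm of the part of y orthogonal to
    v.\<close>
  define I where "I = (\<lambda>x v. \<Sum>i<n. (\<pi> i * y x i) * v i)"
  have I_qform: "qform n (\<lambda>x v. (I x v)\<^sup>2)" unfolding I_def y_def by (intro qform_linear_square) (auto)
  define H where "H = (\<lambda>x v. q x * norm_pi_sq n \<pi> v + (- 1) * (I x v)\<^sup>2)"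
  have H: "qform n H" unfolding H_def
    by (intro qform_add qform_mult[OF qform_norm] qform_mult[OF I_qform] q_poly) auto
  have H_eq: "norm_pi_sq n \<pi> (\<lambda>i. y x i - I x v * v i) = H x v" if "norm_pi_sq n \<pi> v = 1" for x v
  proof -
    have "norm_pi_sq n \<pi> (\<lambda>i. y x i - I x v * v i)
      = (\<Sum>i<n. \<pi> i * (y x i)\<^sup>2 - 2 * I x v * ((\<pi> i * y x i) * v i) + (I x v)\<^sup>2 * (\<pi> i * (v i)\<^sup>2))"
      unfolding norm_pi_sq_def by (intro sum.cong refl) (simp add: power2_eq_square algebra_simps)
    also have "\<dots> = q x - 2 * I x v * I x v + (I x v)\<^sup>2 * norm_pi_sq n \<pi> v"
      by (simp only: sum.distrib sum_subtractf sum_distrib_left[symmetric] q_def norm_pi_sq_def I_def)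
    finally show ?thesis using that by (simp add: H_def power2_eq_square)
  qed
  \<comment> \<open>\<open>S_pi\<close> leaves the coordinates from \<open>n\<close> on free; the
    cube pins them to 0, which gives compactness.\<close>
  define X where "X = cube n N \<inter> S_pi n \<pi>"
  have S_closed: "closed (S_pi n \<pi>)"
  proof -
    have "S_pi n \<pi> = (\<Inter>i\<in>{..<n}. {x. 0 \<le> x i}) \<inter> {x. norm_pi_sq n \<pi> x = 1}"
      by (auto simp: S_pi_def)
    moreover have "closed {x :: nat \<Rightarrow> real. 0 \<le> x i}" for i
      by (intro closed_Collect_le continuous_on_const continuous_on_product_coordinates)
    moreover have "closed {x. norm_pi_sq n \<pi> x = 1}"
      by (intro closed_Collect_eq continuous_on_const is_poly_continuous[OF is_poly_norm])
    ultimately show ?thesis by (auto intro!: closed_Int closed_INT)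
  qed
  have X: "compact X" unfolding X_def by (intro compact_Int_closed compact_cube S_closed)
  \<comment> \<open>Where \<open>H\<close> vanishes, y is a multiple of v. If the multiple is 0,
    then x is (1,...,1) and the choice of \<open>C1\<close> applies; otherwise \<open>G2 x v\<close>
    has the sign of f x > 0.\<close>
  obtain C2 \<eta>2 where C2: "0 < \<eta>2" "\<And>z. z \<in> X \<times> usphere n \<pi> \<Longrightarrow> \<eta>2 \<le> G2 (fst z) (snd z) + C2 * H (fst z) (snd z)"
  proof (rule compact_penalty[of "X \<times> usphere n \<pi>" "\<lambda>z. G2 (fst z) (snd z)" "\<lambda>z. H (fst z) (snd z)"])
    fix z assume z: "z \<in> X \<times> usphere n \<pi>"
    obtain x v where xv: "z = (x, v)" by (cases z)
    have x: "x \<in> S_pi n \<pi>" and v: "v \<in> usphere n \<pi>" "norm_pi_sq n \<pi> v = 1"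
      using z by (auto simp: X_def xv usphere_def)
    show "0 \<le> H (fst z) (snd z)" using H_eq[OF v(2), of x] norm_nonneg by (metis xv fst_conv snd_conv)
    assume "H (fst z) (snd z) = 0"
    then have "\<forall>i<n. y x i - I x v * v i = 0" using H_eq[OF v(2), of x] norm_eq_0_iff xv by simp
    then have y_eq: "y x i = I x v * v i" if "i < n" for i using that by simp
    show "0 < G2 (fst z) (snd z)"
    proof (cases "I x v = 0")
      case True
      then have "x i = 1" if "i < n" for i using y_eq[OF that] by (simp add: y_def)
      then have "G2 x v = G2 (\<lambda>i. 1) v" by (intro qform_cong[OF G2]) auto
      also have "\<dots> = G1 (\<lambda>i. 1) v + C1 * (L v)\<^sup>2" by (simp add: G2_def q1)
      finally show ?thesis using C1(1) C1(2)[OF v(1)] xv by simp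
    next
      case False
      obtain i where i: "i < n" "v i \<noteq> 0" using usphere_ne[OF v(1)] by blast
      then have "x i \<noteq> 1" using y_eq[OF i(1)] False by (auto simp: y_def)
      then have "0 < f x" using fpos[OF x] i by blast
      also have "f x = G2 x (y x)" using x by (simp add: f_G2 s_def S_pi_def)
      also have "\<dots> = G2 x (\<lambda>i. I x v * v i)" using y_eq by (intro qform_cong[OF G2]) auto
      also have "\<dots> = (I x v)\<^sup>2 * G2 x v" by (rule qform_scale[OF G2])
      finally show ?thesis using xv False by (simp add: zero_less_mult_iff)
    qed
  qed (auto intro!: compact_Times X compact_usphere qform_continuous[OF G2] qform_continuous[OF H]
        continuous_on_fst continuous_on_snd)

  text \<open>\<open>H\<close> vanishes at \<open>v = y\<close> (equality in Cauchy--Schwarz).\<close>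
  define G3 where "G3 = (\<lambda>x v. G2 x v + C2 * H x v)"
  have G3: "qform n G3" unfolding G3_def by (intro qform_add qform_mult G2 H) auto
  have "I x (y x) = q x" for x
    unfolding I_def q_def norm_pi_sq_def by (intro sum.cong refl) (simp add: power2_eq_square)
  then have "H x (y x) = 0" for x unfolding H_def by (simp add: power2_eq_square q_fold)
  then have G3_y: "G3 x (y x) = G2 x (y x)" for x by (simp add: G3_def)

  \<comment> \<open>Zero exactly when x is on the sphere and in the nonnegative orthant. The terms
    max 0 (-x_i) are not polynomial and are replaced in \<open>m\<close> below.\<close>
  define p where "p = (\<lambda>x :: nat \<Rightarrow> real. (s x)\<^sup>2 + (\<Sum>i<n. max 0 (- x i)))"
  have p_cont: "continuous_on A p" for A unfolding p_def
    by (intro continuous_intros is_poly_continuous[OF s_poly] continuous_on_product_then_coordinatewise[OF continuous_on_id])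
  obtain C3 \<eta> where C3: "0 \<le> C3" "0 < \<eta>" "\<And>z. z \<in> cube n N \<times> usphere n \<pi> \<Longrightarrow> \<eta> \<le> G3 (fst z) (snd z) + C3 * p (fst z)"
  proof (rule compact_penalty[of "cube n N \<times> usphere n \<pi>" "\<lambda>z. G3 (fst z) (snd z)" "\<lambda>z. p (fst z)"])
    fix z assume z: "z \<in> cube n N \<times> usphere n \<pi>"
    have sum0: "0 \<le> (\<Sum>i<n. max 0 (- fst z i))" by (intro sum_nonneg) auto
    then show "0 \<le> p (fst z)" by (simp add: p_def)
    assume "p (fst z) = 0"
    then have "(s (fst z))\<^sup>2 = 0" and max0: "(\<Sum>i<n. max 0 (- fst z i)) = 0"
      using sum0 by (simp_all add: p_def add_nonneg_eq_0_iff)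
    have "0 \<le> fst z i" if "i < n" for i
    proof -
      have "max 0 (- fst z i) = 0" by (rule sum_nonneg_0[OF _ _ max0]) (use that in auto)
      then show ?thesis by linarith
    qed
    then have "fst z \<in> S_pi n \<pi>" using \<open>(s (fst z))\<^sup>2 = 0\<close> by (simp add: S_pi_def s_def)
    then have "z \<in> X \<times> usphere n \<pi>" using z by (auto simp: X_def)
    from C2(2)[OF this] C2(1) show "0 < G3 (fst z) (snd z)" by (simp add: G3_def)
  qed (auto intro!: compact_Times compact_cube compact_usphere qform_continuous[OF G3]
        continuous_on_compose2[OF p_cont[of UNIV]] continuous_on_fst continuous_on_snd)

  \<comment> \<open>The \<open>n\<close> replacements may lose \<eta>/(2n) each, together half of
    the margin.\<close>
  have "0 < \<eta> / (2 * real n)" using C3 n_pos by simp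
  from orthant_penalty[OF C3(1) this N0] obtain k where
    k: "\<And>t. \<bar>t\<bar> \<le> N \<Longrightarrow> C3 * max 0 (- t) - \<eta> / (2 * real n) \<le> - t * (1 - t / N) ^ (2 * k)" by blast
  define m where "m = (\<lambda>x :: nat \<Rightarrow> real. C3 * (s x)\<^sup>2 - (\<Sum>i<n. x i * (1 - x i / N) ^ (2 * k)))"
  have m_poly: "is_poly n m" unfolding m_def using s_poly by auto
  have m_ge: "C3 * p x - \<eta> / 2 \<le> m x" if x: "x \<in> cube n N" for x
  proof -
    have "(\<Sum>i<n. C3 * max 0 (- x i) - \<eta> / (2 * real n)) \<le> (\<Sum>i<n. - x i * (1 - x i / N) ^ (2 * k))"
      using x by (intro sum_mono k) (auto simp: cube_def)
    moreover have "(\<Sum>i<n. C3 * max 0 (- x i) - \<eta> / (2 * real n)) = C3 * (\<Sum>i<n. max 0 (- x i)) - \<eta> / 2"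
      using n_pos by (simp add: sum_subtractf sum_distrib_left)
    ultimately show ?thesis by (simp add: m_def p_def distrib_left sum_negf)
  qed
  \<comment> \<open>At v = y the new term is m q = C3 s^2 q - (\<Sum> x_i \<sigma>_i): the first
    part is a multiple of \<open>s\<close>, the second supplies the multipliers.\<close>
  define G4 where "G4 = (\<lambda>x v. G3 x v + m x * norm_pi_sq n \<pi> v)"
  have G4: "qform n G4" unfolding G4_def by (intro qform_add qform_mult G3 qform_norm m_poly)
  have "sos_mod n \<pi> (\<lambda>x. G4 x (\<lambda>i. x i - 1))"
  proof (rule qform_positive_sos_mod[OF G4])
    fix x v assume x: "x \<in> cube n N" and v: "v \<in> usphere n \<pi>"
    have "\<eta> \<le> G3 x v + C3 * p x" using C3(3)[of "(x, v)"] x v by simp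
    then show "0 < G4 x v" using m_ge[OF x] C3(2) v by (simp add: G4_def usphere_def)
  qed auto
  then obtain \<sigma>0 \<phi>4 where \<sigma>0: "poly_sos n \<sigma>0" "is_poly n \<phi>4" and
    G4_y: "\<And>x. G4 x (y x) = \<sigma>0 x + \<phi>4 x * s x"
    unfolding sos_mod_def s_def y_def by meson
  define \<sigma> where "\<sigma> = (\<lambda>i x. ((1 - x i / N) ^ k)\<^sup>2 * q x)"
  have "poly_sos n q" unfolding q_def norm_pi_sq_def y_def
    by (intro poly_sos_sum poly_sos_mult poly_sos_const poly_sos_square) (use pos in \<open>auto intro: less_imp_le\<close>)
  then have \<sigma>: "poly_sos n (\<sigma> i)" if "i < n" for i
    unfolding \<sigma>_def using that by (intro poly_sos_mult poly_sos_square) auto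
  define \<phi> where "\<phi> = (\<lambda>x. \<phi>4 x + \<phi>2 x - C3 * s x * q x)"
  have \<phi>: "is_poly n \<phi>" unfolding \<phi>_def using s_poly q_poly \<phi>2 \<sigma>0 by auto
  have "f x = \<sigma>0 x + (\<Sum>i<n. x i * \<sigma> i x) + \<phi> x * (norm_pi_sq n \<pi> x - 1)" for x
  proof -
    have "(\<Sum>i<n. x i * \<sigma> i x) = (\<Sum>i<n. x i * (1 - x i / N) ^ (2 * k)) * q x"
      unfolding sum_distrib_right \<sigma>_def by (simp add: power_mult mult.commute[of 2 k] mult.assoc)
    then have m_q: "m x * q x = C3 * (s x)\<^sup>2 * q x - (\<Sum>i<n. x i * \<sigma> i x)"
      unfolding m_def by (simp add: left_diff_distrib)
    have "f x = G4 x (y x) - m x * q x + \<phi>2 x * s x"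
      unfolding f_G2 G4_def G3_y by (simp add: q_def)
    then show ?thesis unfolding G4_y m_q \<phi>_def s_fold by (simp add: power2_eq_square algebra_simps)
  qed
  then show ?thesis using \<sigma>0(1) \<sigma> \<phi> by blast
qed

end

section \<open>Markov kernels and the log-Sobolev constant\<close>

lemma stationary_kpow:
  assumes "stationary n K \<pi>" "j < n"
  shows "(\<Sum>i<n. \<pi> i * kpow n K m i j) = \<pi> j"
  using assms(2)
proof (induction m arbitrary: j)
  case 0
  have "(\<Sum>i<n. \<pi> i * kpow n K 0 i j) = (\<Sum>i<n. if i = j then \<pi> i else 0)"
    by (intro sum.cong) auto
  then show ?case using 0 by simp
next
  case (Suc m)
  have "(\<Sum>i<n. \<pi> i * kpow n K (Suc m) i j) = (\<Sum>l<n. (\<Sum>i<n. \<pi> i * kpow n K m i l) * K l j)"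
    unfolding kpow.simps sum_distrib_left sum_distrib_right by (subst sum.swap) (simp add: mult.assoc)
  also have "\<dots> = (\<Sum>l<n. \<pi> l * K l j)" using Suc.IH by (intro sum.cong) auto
  also have "\<dots> = \<pi> j" using assms(1) Suc.prems by (simp add: stationary_def)
  finally show ?case .
qed

lemma kpow_nonneg:
  assumes "markov_kernel n K" "i < n" "j < n"
  shows "0 \<le> kpow n K m i j"
  using assms(3)
proof (induction m arbitrary: j)
  case (Suc m)
  then show ?case using assms by (auto simp: markov_kernel_def intro!: sum_nonneg mult_nonneg_nonneg)
qed auto

text \<open>Some state has positive mass; irreducibility moves part of it to \<open>j\<close> in
  finitely many steps, and \<pi> is invariant under powers of K.\<close>

lemma stationary_pos:
  assumes K: "markov_kernel n K" and irr: "irreducible_kernel n K" and st: "stationary n K \<pi>" and j: "j < n"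
  shows "0 < \<pi> j"
proof -
  have nn: "\<And>i. i < n \<Longrightarrow> 0 \<le> \<pi> i" and s1: "(\<Sum>i<n. \<pi> i) = 1" using st by (auto simp: stationary_def)
  have "\<exists>i<n. \<pi> i \<noteq> 0"
  proof (rule ccontr)
    assume "\<not> (\<exists>i<n. \<pi> i \<noteq> 0)"
    then have "(\<Sum>i<n. \<pi> i) = 0" by (intro sum.neutral) auto
    then show False using s1 by simp
  qed
  then obtain i where i: "i < n" "0 < \<pi> i" using nn by force
  obtain m where m: "0 < kpow n K m i j" using irr i j by (auto simp: irreducible_kernel_def)
  have "0 < \<pi> i * kpow n K m i j" using i m by simp
  also have "\<dots> \<le> (\<Sum>i<n. \<pi> i * kpow n K m i j)"
    using i j nn kpow_nonneg[OF K] by (intro member_le_sum) auto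
  also have "\<dots> = \<pi> j" by (rule stationary_kpow[OF st j])
  finally show ?thesis .
qed

section \<open>The Dirichlet form and the entropy\<close>

lemma dirichlet_nonneg:
  assumes "markov_kernel n K" "stationary n K \<pi>"
  shows "0 \<le> dirichlet n K \<pi> x"
  using assms unfolding dirichlet_def markov_kernel_def stationary_def
  by (auto intro!: sum_nonneg mult_nonneg_nonneg)

text \<open>Every summand vanishes and \<pi> is positive, so x agrees across each transition of
  positive probability, hence along paths; irreducibility connects all states.\<close>

lemma dirichlet_eq_0:
  assumes K: "markov_kernel n K" and irr: "irreducible_kernel n K" and st: "stationary n K \<pi>"
    and E: "dirichlet n K \<pi> x = 0" and ij: "i < n" "j < n"
  shows "x i = x j"
proof -
  have t: "0 \<le> \<pi> i * K i j * (x i - x j)\<^sup>2" if "i < n" "j < n" for i j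
    using K st that by (auto simp: markov_kernel_def stationary_def)
  have "(\<Sum>i<n. \<Sum>j<n. \<pi> i * K i j * (x i - x j)\<^sup>2) = 0" using E by (simp add: dirichlet_def)
  then have "(\<Sum>j<n. \<pi> i * K i j * (x i - x j)\<^sup>2) = 0" if "i < n" for i
    by (rule sum_nonneg_0[of "{..<n}", rotated 2]) (use that in \<open>auto intro!: sum_nonneg t\<close>)
  then have term0: "\<pi> i * K i j * (x i - x j)\<^sup>2 = 0" if "i < n" "j < n" for i j
    by (rule sum_nonneg_0[of "{..<n}", rotated 2]) (use that in \<open>auto intro!: t\<close>)
  have step: "x i = x j" if "i < n" "j < n" "K i j \<noteq> 0" for i j
    using term0[OF that(1,2)] that(3) stationary_pos[OF K irr st that(1)] by simp
  have "kpow n K m i j \<noteq> 0 \<Longrightarrow> x i = x j" if "j < n" for m j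
    using that
  proof (induction m arbitrary: j)
    case (Suc m)
    then obtain l where "l < n" "kpow n K m i l * K l j \<noteq> 0"
      by (metis (mono_tags, lifting) kpow.simps(2) lessThan_iff sum.neutral)
    then show ?case using Suc.IH[of l] step[of l j] Suc.prems by auto
  qed (auto split: if_splits)
  then show ?thesis using irr ij by (metis irreducible_kernel_def less_irrefl)
qed

lemma dirichlet_shift: "dirichlet n K \<pi> (\<lambda>i. x i - c) = dirichlet n K \<pi> x"
  by (simp add: dirichlet_def)

lemma dirichlet_scale: "dirichlet n K \<pi> (\<lambda>i. t * x i) = t\<^sup>2 * dirichlet n K \<pi> x"
proof -
  have "(t * x i - t * x j)\<^sup>2 = t\<^sup>2 * (x i - x j)\<^sup>2" for i j
    by (simp add: power_mult_distrib flip: right_diff_distrib)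
  then show ?thesis by (simp add: dirichlet_def sum_distrib_left mult_ac)
qed

lemma dirichlet_abs_le:
  assumes "markov_kernel n K" "stationary n K \<pi>"
  shows "dirichlet n K \<pi> (\<lambda>i. \<bar>x i\<bar>) \<le> dirichlet n K \<pi> x"
proof -
  have "(\<bar>a\<bar> - \<bar>b\<bar>)\<^sup>2 \<le> (a - b)\<^sup>2" for a b :: real
    by (rule abs_le_square_iff[THEN iffD1]) auto
  then show ?thesis using assms unfolding dirichlet_def markov_kernel_def stationary_def
    by (auto intro!: mult_left_mono sum_mono)
qed

lemma poly_deg_le_dirichlet: "poly_deg_le n 2 (dirichlet n K \<pi>)"
proof -
  have lin: "poly_deg_le n 1 (\<lambda>x. x i - x j)" if "i < n" "j < n" for i j
    using poly_deg_le_add[OF poly_deg_le_coord[OF that(1)] poly_deg_le_cmult[OF poly_deg_le_coord[OF that(2)], of "-1"]]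
    by simp
  have "poly_deg_le n 2 (\<lambda>x. (x i - x j)\<^sup>2)" if "i < n" "j < n" for i j
    using poly_deg_le_mult[OF lin[OF that] lin[OF that]] by (simp add: power2_eq_square numeral_2_eq_2)
  then show ?thesis unfolding dirichlet_def
    by (intro poly_deg_le_cmult poly_deg_le_sum) auto
qed

lemma ent_scale_abs:
  assumes "c \<noteq> 0"
  shows "ent n \<pi> (\<lambda>i. c * \<bar>x i\<bar>) = c\<^sup>2 * ent n \<pi> x"
proof -
  have "norm_pi_sq n \<pi> (\<lambda>i. c * \<bar>x i\<bar>) = c\<^sup>2 * norm_pi_sq n \<pi> x"
    by (simp add: norm_pi_sq_def sum_distrib_left power_mult_distrib mult_ac)
  then show ?thesis using assms unfolding ent_def sum_distrib_left
    by (intro sum.cong refl) (simp add: power_mult_distrib)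
qed

context weighted_sphere
begin

text \<open>Normalizing |x| gives a point of \<open>S_pi\<close>: both sides are homogeneous of
  degree 2, the entropy ignores signs, and taking absolute values does not increase the Dirichlet
  form.\<close>

lemma ent_le_dirichlet:
  assumes K: "markov_kernel n K" "stationary n K \<pi>" and g: "0 \<le> g"
    and le: "\<And>x. x \<in> S_pi n \<pi> \<Longrightarrow> ent n \<pi> x \<le> g * dirichlet n K \<pi> x"
  shows "ent n \<pi> x \<le> g * dirichlet n K \<pi> x"
proof (cases "norm_pi_sq n \<pi> x = 0")
  case True
  then have "ent n \<pi> x = 0" unfolding norm_eq_0_iff ent_def by (intro sum.neutral) auto
  then show ?thesis using g dirichlet_nonneg[OF K] by simp
next
  case False
  define r where "r = sqrt (norm_pi_sq n \<pi> x)"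
  have r: "r > 0" "r\<^sup>2 = norm_pi_sq n \<pi> x" using False norm_nonneg[of x] by (auto simp: r_def)
  define z where "z = (\<lambda>i. (1 / r) * \<bar>x i\<bar>)"
  have "norm_pi_sq n \<pi> z = (1 / r)\<^sup>2 * norm_pi_sq n \<pi> (\<lambda>i. \<bar>x i\<bar>)"
    unfolding z_def by (rule qform_scale[OF qform_norm])
  also have "norm_pi_sq n \<pi> (\<lambda>i. \<bar>x i\<bar>) = r\<^sup>2" unfolding r(2) by (simp add: norm_pi_sq_def)
  also have "(1 / r)\<^sup>2 * r\<^sup>2 = 1" using r(1) by (simp add: power_divide)
  finally have z: "z \<in> S_pi n \<pi>" using r by (auto simp: S_pi_def z_def)
  have "(1 / r)\<^sup>2 * ent n \<pi> x = ent n \<pi> z" unfolding z_def using r(1) by (intro ent_scale_abs[symmetric]) auto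
  also have "\<dots> \<le> g * dirichlet n K \<pi> z" by (rule le[OF z])
  also have "dirichlet n K \<pi> z = (1 / r)\<^sup>2 * dirichlet n K \<pi> (\<lambda>i. \<bar>x i\<bar>)"
    unfolding z_def by (rule dirichlet_scale)
  also have "g * \<dots> \<le> g * ((1 / r)\<^sup>2 * dirichlet n K \<pi> x)"
    using g dirichlet_abs_le[OF K] by (intro mult_left_mono) auto
  finally have "(1 / r)\<^sup>2 * ent n \<pi> x \<le> (1 / r)\<^sup>2 * (g * dirichlet n K \<pi> x)" by (simp add: mult_ac)
  then show ?thesis by (rule mult_left_le_imp_le) (use r(1) in auto)
qed

text \<open>The witness is the normalized indicator of state 0; its entropy ln (1/\<pi>_0) is
  positive because a second state forces \<pi>_0 < 1.\<close>

lemma ent_positive_point: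
  assumes "2 \<le> n"
  obtains x where "x \<in> S_pi n \<pi>" "0 < ent n \<pi> x"
proof -
  define x where "x = (\<lambda>i::nat. if i = 0 then 1 / sqrt (\<pi> 0) else (0::real))"
  have p: "0 < \<pi> 0" "0 < \<pi> 1" using assms pos by auto
  have "(\<Sum>i\<in>{0,1}. \<pi> i) \<le> (\<Sum>i<n. \<pi> i)"
    using assms pos by (intro sum_mono2) (auto intro: less_imp_le)
  then have p1: "\<pi> 0 < 1" using p sum1 by simp
  have x0: "(x 0)\<^sup>2 = 1 / \<pi> 0" using p by (simp add: x_def power_divide)
  have "norm_pi_sq n \<pi> x = (\<Sum>i<n. if i = 0 then 1 else 0)"
    unfolding norm_pi_sq_def using x0 p by (intro sum.cong refl) (auto simp: x_def)
  also have "\<dots> = 1" using assms by simp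
  finally have norm1: "norm_pi_sq n \<pi> x = 1" .
  have "ent n \<pi> x = (\<Sum>i<n. if i = 0 then ln (1 / \<pi> 0) else 0)"
    unfolding ent_def norm1 using x0 p by (intro sum.cong refl) (auto simp: x_def)
  also have "\<dots> = ln (1 / \<pi> 0)" using assms by simp
  also have "\<dots> > 0" using p p1 by simp
  finally have "0 < ent n \<pi> x" .
  moreover have "x \<in> S_pi n \<pi>" using norm1 p by (auto simp: S_pi_def x_def)
  ultimately show ?thesis using that by blast
qed

end

section \<open>Comparison of the sum-of-squares bounds with the log-Sobolev constant\<close>

lemma SOS_S_nonneg:
  assumes "f \<in> SOS_S n \<pi> d" "x \<in> S_pi n \<pi>"
  shows "0 \<le> f x"
proof -
  have sos_nonneg: "0 \<le> \<sigma> x" if "sos n k \<sigma>" for k \<sigma>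
    using that by (auto simp: sos_def intro!: sum_list_nonneg)
  obtain \<sigma>0 \<sigma> \<phi> where "sos n d \<sigma>0" "\<forall>i<n. sos n (d - 1) (\<sigma> i)"
    "f = (\<lambda>x. \<sigma>0 x + (\<Sum>i<n. x i * \<sigma> i x) + \<phi> x * (norm_pi_sq n \<pi> x - 1))"
    using assms(1) unfolding SOS_S_def by (elim CollectE conjE exE) (rule that)
  then show ?thesis using assms(2) sos_nonneg
    by (auto simp: S_pi_def intro!: add_nonneg_nonneg sum_nonneg mult_nonneg_nonneg)
qed

theorem mainTheorem2:
  fixes n :: nat and K :: "nat \<Rightarrow> nat \<Rightarrow> real" and \<pi> :: "nat \<Rightarrow> real"
    and \<epsilon> :: real and P :: "(nat \<Rightarrow> real) \<Rightarrow> real"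
  assumes "2 \<le> n"
    and "markov_kernel n K" and "irreducible_kernel n K" and "stationary n K \<pi>"
    and "0 < \<epsilon>" and "\<epsilon> < 1"
    and "is_poly n P"
    and "\<forall>x\<in>S_pi n \<pi>. ent n \<pi> x \<le> P x \<and> P x \<le> (1 + \<epsilon>) * ent n \<pi> x"
  shows "(\<forall>d. poly_degree n P \<le> 2 * d \<longrightarrow> alpha_P n K \<pi> P d \<le> log_sobolev n K \<pi>)
       \<and> (\<exists>d0. \<forall>d\<ge>d0. poly_degree n P \<le> 2 * d \<longrightarrow>
              (1 - \<epsilon>) * log_sobolev n K \<pi> \<le> alpha_P n K \<pi> P d)"
proof -
  note K = assms(2) and irr = assms(3) and st = assms(4)
  have pos: "\<And>i. i < n \<Longrightarrow> 0 < \<pi> i" using stationary_pos[OF K irr st] .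
  have sum1: "(\<Sum>i<n. \<pi> i) = 1" using st by (simp add: stationary_def)
  \<comment> \<open>This gives N \<ge> 1 and hence 1/\<pi>_i \<le> N \<le> N^2.\<close>
  define N where "N = 1 + (\<Sum>i<n. 1 / \<pi> i)"
  have "0 \<le> (\<Sum>i<n. 1 / \<pi> i)" using pos by (intro sum_nonneg) (auto intro: less_imp_le)
  then have N1: "1 \<le> N" by (simp add: N_def)
  have N: "1 \<le> N\<^sup>2 * \<pi> i" if i: "i < n" for i
  proof -
    have "1 / \<pi> i \<le> (\<Sum>i<n. 1 / \<pi> i)" using i pos by (intro member_le_sum) (auto intro: less_imp_le)
    then have "1 / \<pi> i \<le> N" by (simp add: N_def)
    also have "N \<le> N\<^sup>2" using N1 by (simp add: power2_eq_square)
    finally show ?thesis using pos[OF i] by (simp add: field_simps)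
  qed
  interpret weighted_sphere n \<pi> N
    using pos sum1 N N1 by unfold_locales auto
  define E where "E = dirichlet n K \<pi>"
  define \<alpha> where "\<alpha> = log_sobolev n K \<pi>"
  define A where "A = {a. \<forall>x. a * ent n \<pi> x \<le> E x}"
  have \<alpha>_def': "\<alpha> = Sup A" by (simp add: \<alpha>_def log_sobolev_def A_def E_def)
  have E0: "0 \<le> E x" for x unfolding E_def by (rule dirichlet_nonneg[OF K st])
  \<comment> \<open>One point of positive entropy bounds \<open>A\<close> above, so its supremum is
    meaningful; it also forces every admissible \<gamma> to be positive.\<close>
  obtain x0 where x0: "x0 \<in> S_pi n \<pi>" "0 < ent n \<pi> x0" using ent_positive_point[OF assms(1)] .
  have bdd: "bdd_above A"
  proof (rule bdd_aboveI)
    fix a assume "a \<in> A"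
    then have "a * ent n \<pi> x0 \<le> E x0" by (simp add: A_def)
    then show "a \<le> E x0 / ent n \<pi> x0" using x0 by (simp add: field_simps)
  qed
  have "0 \<in> A" using E0 by (simp add: A_def)
  then have \<alpha>0: "0 \<le> \<alpha>" unfolding \<alpha>_def' by (rule cSup_upper[OF _ bdd])
  \<comment> \<open>The supremum is itself admissible: where the entropy is positive it is below the
    quotient E/Ent, and elsewhere \<alpha> \<ge> 0 suffices.\<close>
  have \<alpha>_ent: "\<alpha> * ent n \<pi> x \<le> E x" for x
  proof (cases "0 < ent n \<pi> x")
    case True
    have "Sup A \<le> E x / ent n \<pi> x"
    proof (rule cSup_least)
      show "A \<noteq> {}" using \<open>0 \<in> A\<close> by blast
      fix a assume "a \<in> A"
      then show "a \<le> E x / ent n \<pi> x" using True by (simp add: A_def field_simps)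
    qed
    then show ?thesis using True by (simp add: \<alpha>_def' field_simps)
  next
    case False
    then have "\<alpha> * ent n \<pi> x \<le> 0" using \<alpha>0 by (simp add: mult_nonneg_nonpos)
    then show ?thesis using E0[of x] by linarith
  qed
  have gamma: "0 < \<gamma> \<and> 1 / \<gamma> \<le> \<alpha>" if "\<gamma> \<in> gamma_set n K \<pi> P d" for \<gamma> d
  proof -
    have le: "ent n \<pi> x \<le> \<gamma> * E x" if x: "x \<in> S_pi n \<pi>" for x
    proof -
      have "0 \<le> \<gamma> * E x - P x"
        using SOS_S_nonneg[OF _ x, of "\<lambda>x. \<gamma> * E x - P x" d] \<open>\<gamma> \<in> gamma_set n K \<pi> P d\<close>
        by (simp add: gamma_set_def E_def)
      then show ?thesis using assms(8) x by force
    qed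
    have "0 < \<gamma> * E x0" using le[OF x0(1)] x0(2) by linarith
    then have \<gamma>: "0 < \<gamma>" using E0[of x0] by (auto simp: zero_less_mult_iff)
    have "1 / \<gamma> * ent n \<pi> x \<le> E x" for x
      using ent_le_dirichlet[OF K st, of \<gamma> x] le \<gamma> by (simp add: E_def field_simps)
    then have "1 / \<gamma> \<in> A" by (simp add: A_def)
    then show ?thesis using \<gamma> cSup_upper[OF _ bdd] by (auto simp: \<alpha>_def')
  qed
  have alpha_P_le: "alpha_P n K \<pi> P d \<le> \<alpha>" for d
  proof (cases "gamma_set n K \<pi> P d = {}")
    case True
    then show ?thesis using \<alpha>0 by (simp add: alpha_P_def)
  next
    case False
    then obtain \<gamma> where "\<gamma> \<in> gamma_set n K \<pi> P d" by blast
    then have "0 < 1 / \<gamma>" "1 / \<gamma> \<le> \<alpha>" using gamma by auto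
    then have \<alpha>: "0 < \<alpha>" by linarith
    have "1 / \<alpha> \<le> \<gamma>" if "\<gamma> \<in> gamma_set n K \<pi> P d" for \<gamma>
      using gamma[OF that] \<alpha> by (auto simp: field_simps)
    then have "1 / \<alpha> \<le> Inf (gamma_set n K \<pi> P d)" using False by (intro cInf_greatest)
    then have "1 / Inf (gamma_set n K \<pi> P d) \<le> 1 / (1 / \<alpha>)" using \<alpha> by (intro frac_le) auto
    then show ?thesis using False by (simp add: alpha_P_def)
  qed
  have alpha_P_nonneg: "0 \<le> alpha_P n K \<pi> P d" for d
  proof (cases "gamma_set n K \<pi> P d = {}")
    case False
    then have "0 \<le> Inf (gamma_set n K \<pi> P d)" using gamma by (intro cInf_greatest) (auto intro: less_imp_le)
    then show ?thesis by (simp add: alpha_P_def)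
  qed (simp add: alpha_P_def)
  have "\<exists>d0. \<forall>d\<ge>d0. poly_degree n P \<le> 2 * d \<longrightarrow> (1 - \<epsilon>) * \<alpha> \<le> alpha_P n K \<pi> P d"
  \<comment> \<open>For \<alpha> = 0 the bound is just nonnegativity; the witness \<gamma> below
    needs \<alpha> > 0.\<close>
  proof (cases "\<alpha> = 0")
    case True
    then show ?thesis using alpha_P_nonneg by simp
  next
    case False
    then have \<alpha>: "0 < \<alpha>" using \<alpha>0 by simp
    define \<gamma> where "\<gamma> = 1 / ((1 - \<epsilon>) * \<alpha>)"
    \<comment> \<open>The slack left after P \<le> (1 + \<epsilon>) Ent \<le> (1 + \<epsilon>)
      E/\<alpha>; positive because (1 + \<epsilon>)(1 - \<epsilon>) < 1.\<close>
    define c where "c = \<gamma> - (1 + \<epsilon>) / \<alpha>"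
    have "(1 - \<epsilon>\<^sup>2) < 1" using assms(5) by simp
    then have "(1 + \<epsilon>) * (1 - \<epsilon>) < 1" by (simp add: power2_eq_square algebra_simps)
    then have "(1 + \<epsilon>) < 1 / (1 - \<epsilon>)" using assms(6) by (simp add: field_simps)
    then have "(1 + \<epsilon>) / \<alpha> < 1 / (1 - \<epsilon>) / \<alpha>" using \<alpha> by (intro divide_strict_right_mono)
    then have c: "0 < c" by (simp add: c_def \<gamma>_def)
    define f where "f = (\<lambda>x. \<gamma> * E x - P x)"
    have E_poly: "is_poly n E" unfolding E_def is_poly_def using poly_deg_le_dirichlet by blast
    have f_poly: "is_poly n f" unfolding f_def using E_poly assms(7) by auto
    have f_ge: "c * E x \<le> f x" if x: "x \<in> S_pi n \<pi>" for x
    proof -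
      have "P x \<le> (1 + \<epsilon>) * ent n \<pi> x" using assms(8) x by blast
      also have "\<dots> \<le> (1 + \<epsilon>) * (E x / \<alpha>)"
        using \<alpha>_ent[of x] \<alpha> assms(5) by (intro mult_left_mono) (auto simp: field_simps)
      finally show ?thesis by (simp add: f_def c_def left_diff_distrib)
    qed
    have E_pos: "0 < E x" if "i < n" "j < n" "x i \<noteq> x j" for x i j
      using dirichlet_eq_0[OF K irr st, of x i j] that E0[of x] by (force simp: E_def)
    have one_S: "(\<lambda>i. 1) \<in> S_pi n \<pi>" using sum1 by (simp add: S_pi_def norm_pi_sq_def)
    have norm_one: "norm_pi_sq n \<pi> (\<lambda>i. 1) = 1" using sum1 by (simp add: norm_pi_sq_def)
    have "ent n \<pi> (\<lambda>i. 1) = 0" by (simp add: ent_def norm_one)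
    then have P1: "P (\<lambda>i. 1) = 0" using assms(8) one_S by force
    have "\<exists>\<sigma>0 \<sigma> \<phi>. poly_sos n \<sigma>0 \<and> (\<forall>i<n. poly_sos n (\<sigma> i)) \<and> is_poly n \<phi> \<and>
      f = (\<lambda>x. \<sigma>0 x + (\<Sum>i<n. x i * \<sigma> i x) + \<phi> x * (norm_pi_sq n \<pi> x - 1))"
    \<comment> \<open>E is a quadratic form unchanged by adding constants, so c E serves as
      \<open>Q\<close> both at x - 1 and at x. It is positive on nonzero tangent vectors, since a
      constant of weighted mean 0 is 0.\<close>
    proof (rule local_global_sos[OF f_poly, where Q = "\<lambda>x. c * E x"])
      show "f (\<lambda>i. 1) = 0" by (simp add: f_def P1 E_def dirichlet_def)
      show "is_poly n (\<lambda>x. c * E x)" using E_poly by auto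
      show "c * E (\<lambda>i. t * v i) = t\<^sup>2 * (c * E v)" for t v
        unfolding E_def dirichlet_scale by simp
      show "0 < c * E v" if tan: "(\<Sum>i<n. \<pi> i * v i) = 0" and v: "\<exists>i<n. v i \<noteq> 0" for v
      proof -
        obtain i where i: "i < n" "v i \<noteq> 0" using v by blast
        have "\<exists>j<n. v i \<noteq> v j"
        proof (rule ccontr)
          assume "\<not> (\<exists>j<n. v i \<noteq> v j)"
          then have "(\<Sum>j<n. \<pi> j * v j) = (\<Sum>j<n. \<pi> j) * v i"
            unfolding sum_distrib_right by (intro sum.cong) auto
          then show False using tan sum1 i by simp
        qed
        then show ?thesis using E_pos i c by (metis mult_pos_pos)
      qed
      show "c * E (\<lambda>i. x i - 1) \<le> f x" if "x \<in> S_pi n \<pi>" for x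
        using f_ge[OF that] by (simp add: E_def dirichlet_shift)
      show "0 < f x" if x: "x \<in> S_pi n \<pi>" and x1: "\<exists>i<n. x i \<noteq> 1" for x
      proof -
        obtain i where i: "i < n" "x i \<noteq> 1" using x1 by blast
        have "\<exists>j<n. x i \<noteq> x j"
        proof (rule ccontr)
          assume *: "\<not> (\<exists>j<n. x i \<noteq> x j)"
          have "norm_pi_sq n \<pi> x = (\<Sum>j<n. \<pi> j) * (x i)\<^sup>2"
            unfolding norm_pi_sq_def sum_distrib_right using * by (intro sum.cong) auto
          then have "(x i)\<^sup>2 = 1" "0 \<le> x i" using x sum1 i by (auto simp: S_pi_def)
          then show False using i by (simp add: power2_eq_1_iff)
        qed
        then have "0 < c * E x" using E_pos i c by (metis mult_pos_pos)
        then show ?thesis using f_ge[OF x] by linarith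
      qed
    qed
    then obtain \<sigma>0 \<sigma> \<phi> where *: "poly_sos n \<sigma>0" "\<forall>i<n. poly_sos n (\<sigma> i)" "is_poly n \<phi>"
      "f = (\<lambda>x. \<sigma>0 x + (\<Sum>i<n. x i * \<sigma> i x) + \<phi> x * (norm_pi_sq n \<pi> x - 1))" by blast
    obtain k where k: "poly_deg_le n k \<phi>" using *(3) by (auto simp: is_poly_def)
    have "\<forall>\<^sub>F d in sequentially. \<forall>i\<in>{..<n}. sos n d (\<sigma> i)"
      using *(2) by (intro eventually_ball_finite) (auto intro: poly_sos_imp_sos)
    with poly_sos_imp_sos[OF *(1)]
    have "\<forall>\<^sub>F d in sequentially. sos n d \<sigma>0 \<and> (\<forall>i\<in>{..<n}. sos n d (\<sigma> i))"
      by (rule eventually_conj)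
    then obtain d1 where d1: "\<And>d. d \<ge> d1 \<Longrightarrow> sos n d \<sigma>0 \<and> (\<forall>i\<in>{..<n}. sos n d (\<sigma> i))"
      by (auto simp: eventually_sequentially)
    show ?thesis
    \<comment> \<open>This threshold gives d - 1 \<ge> d1 for the multipliers, 2 d - 2 \<ge> k for
      \<phi>, and d > 0, which excludes the special case in \<open>SOS_S\<close>.\<close>
    proof (intro exI[of _ "d1 + k + 2"] allI impI)
      fix d assume d: "d1 + k + 2 \<le> d" and deg: "poly_degree n P \<le> 2 * d"
      have "poly_deg_le n (2 * d) (\<lambda>x. \<gamma> * E x + (- 1) * P x)"
        using poly_deg_le_degree[OF assms(7) deg] poly_deg_le_mono[OF poly_deg_le_dirichlet, of "2 * d" n K \<pi>] d
        unfolding E_def by (intro poly_deg_le_add poly_deg_le_cmult) auto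
      then have "poly_deg_le n (2 * d) f" by (simp add: f_def)
      moreover have "sos n d \<sigma>0" "\<forall>i<n. sos n (d - 1) (\<sigma> i)" using d1[of d] d1[of "d - 1"] d by auto
      moreover have "poly_deg_le n (2 * d - 2) \<phi>" using d by (intro poly_deg_le_mono[OF k]) auto
      ultimately have "f \<in> SOS_S n \<pi> d"
        unfolding SOS_S_def mem_Collect_eq using *(4) d
        by (intro conjI exI[of _ \<sigma>0] exI[of _ \<sigma>] exI[of _ \<phi>]) auto
      then have mem: "\<gamma> \<in> gamma_set n K \<pi> P d" by (simp add: gamma_set_def f_def E_def)
      \<comment> \<open>The upper bound on 1/\<gamma>' keeps the infimum positive, so taking
        reciprocals reverses Inf \<le> \<gamma>.\<close>
      have lb: "1 / \<alpha> \<le> \<gamma>'" if "\<gamma>' \<in> gamma_set n K \<pi> P d" for \<gamma>'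
        using gamma[OF that] \<alpha> by (auto simp: field_simps)
      have "Inf (gamma_set n K \<pi> P d) \<le> \<gamma>" using mem lb by (intro cInf_lower bdd_belowI)
      moreover have "1 / \<alpha> \<le> Inf (gamma_set n K \<pi> P d)" using mem lb by (intro cInf_greatest) auto
      moreover have "0 < 1 / \<alpha>" using \<alpha> by simp
      ultimately have "1 / \<gamma> \<le> 1 / Inf (gamma_set n K \<pi> P d)"
        by (intro frac_le) linarith+
      moreover have "alpha_P n K \<pi> P d = 1 / Inf (gamma_set n K \<pi> P d)" using mem by (auto simp: alpha_P_def)
      ultimately show "(1 - \<epsilon>) * \<alpha> \<le> alpha_P n K \<pi> P d" by (simp add: \<gamma>_def)
    qed
  qed
  then show ?thesis using alpha_P_le by (simp add: \<alpha>_def)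
qed

end
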